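(* In the setting and notation of the context (a truncated quiver algebra $A=K\Delta/R_\Delta^n$, the $2$-cocycle $\alpha=k\sum_{i=1}^s\alpha_i$ attached to a cycle of length $s$ with $n+1\le s\le 2n-2$, and the Hochschild extension algebra $T_\alpha(A)$), let $C$ be an oriented cycle in $K\Delta_{T_\alpha(A)}$. Then the following conditions are equivalent: (i) $C$ is an elementary cycle or an $\alpha$-revived cycle; (ii) $C$ is nonzero in $T_\alpha(A)$.
   Context: Conventions: paths are composed from left to right ($pq$ means $p$ followed by $q$, so $t(p)=s(q)$, where $s,t$ denote source and target); $e_h$ is the trivial path at a vertex $h$; an oriented cycle is a path of length $\ge 1$ with equal source and target. Setting. $K$ is an algebraically closed field, $\Delta$ is a finite connected quiver with vertex set $\Delta_0$ and arrow set $\Delta_1$, $R_\Delta\subset K\Delta$ is the ideal generated by the arrows, $n\ge 2$, and $A=K\Delta/R_\Delta^n$. It is assumed that every oriented cycle in $\Delta$ is zero in $A$ and that $\dim_K A>1$. $\Delta_+$ is the set of paths in $\Delta$ of length $\ge1$. $\overline{p}$ is the class in $A$ of a path $p$. Let $\mathbb M=\{p_1,\dots,p_t\}$ be a set of paths in $\Delta$ whose classes form a basis of $\mathrm{soc}_{A^e}A$ (the socle of $A$ as a bimodule); extend it by paths $p_{t+1},\dots,p_d$ to a basis $\{\overline{p_1},\dots,\overline{p_d}\}$ of $A$ (consisting of the classes of all paths of length $<n$), with dual basis $\{\overline{p_1}^*,\dots,\overline{p_d}^*\}$ of $D(A)=\mathrm{Hom}_K(A,K)$. $D(A)$ is an $A$-bimodule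 via $(afb)(x)=f(bxa)$. Cocycle. Let $n+1\le s\le 2n-2$ and let $\gamma=x_1x_2\cdots x_s$ be an oriented cycle of length $s$ in $\Delta$; indices of $x_i$ are read modulo $s$. For $1\le i\le s$ let $\alpha_i:A\times A\to D(A)$ be the bilinear map given on paths $a,b$ of $\Delta$ with $\overline a,\overline b\ne0$ in $A$, with $m$ the length of $ab$, by: $\alpha_i(\overline a,\overline b)=\overline{x_{i+m}\cdots x_{i+s-1}}^*$ if $n\le m<s$ and $ab=x_i\cdots x_{i+m-1}$; $\alpha_i(\overline a,\overline b)=\overline{e_{s(x_i)}}^*$ if $ab=x_i\cdots x_{i+s-1}$; and $0$ otherwise. Fix $0\ne k\in K$ and put $\alpha=k\sum_{i=1}^s\alpha_i$, a Hochschild $2$-cocycle. $T_\alpha(A)$ is the $K$-algebra $A\oplus D(A)$ with multiplication $(a,f)(b,g)=(ab,\,ag+fb+\alpha(a,b))$. Quiver. $\Delta_{T_\alpha(A)}$ is the quiver with vertex set $\Delta_0$ and arrow set $\Delta_1\cup\{y_{p_1},\dots,y_{p_t}\}$, where $y_{p_i}$ is an arrow from $t(p_i)$ to $s(p_i)$ (it is the ordinary quiver of $T_\alpha(A)$). $\Phi:K\Delta_{T_\alpha(A)}\to T_\alpha(A)$ is the surjective $K$-algebra homomorphism with $\Phi(e_h)=(\overline{e_h},0)$ for vertices $h$, $\Phi(a)=(\overline a,0)$ for $a\in\Delta_1$, $\Phi(y_{p_i})=(0,\overline{p_i}^* )$. An element of $K\Delta_{T_\alpha(A)}$ is said to be zero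 in $T_\alpha(A)$ if its image under $\Phi$ is zero. Cycles. An oriented cycle $C$ in $\Delta_{T_\alpha(A)}$ is elementary if $C=\delta_2y_{p_i}\delta_1$ for some paths $\delta_1,\delta_2$ in $\Delta$ (possibly trivial) and $p_i\in\mathbb M$ with $\overline{p_i}^*(\overline{\delta_1\delta_2})\ne0$. An oriented cycle $C=a_1\cdots a_j$ with all $a_r\in\Delta_1$ is $\alpha$-revived if there are $a,b\in\Delta_+$ with $\overline a,\overline b\neq0$ in $A$, $C=ab$ and $\alpha(\overline a,\overline b)\ne0$. *)

theory Defs
  imports
    "HOL-Computational_Algebra.Polynomial"
    "Graph_Theory.Digraph_Component"
    "HOL-Algebra.Module"
    "HOL-Algebra.QuotRing"
    "HOL-Algebra.Ideal_Product"
begin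

hide_const (open) Polynomial.smult

section \<open>Quivers and paths\<close>

text \<open>A finite quiver is a \<^locale>\<open>fin_digraph\<close> (parallel arcs and loops are allowed).
  A path is a pair of its source and its list of arrows, read from left to right, so that
  the trivial path at \<open>h\<close> is \<open>(h, [])\<close>.\<close>

type_synonym ('v, 'e) qpath = "'v \<times> 'e list"

definition paths :: "('v, 'e) pre_digraph \<Rightarrow> ('v, 'e) qpath set" where
  "paths Q = {(u, w). \<exists>v. pre_digraph.awalk Q u w v}"

abbreviation path_src :: "('v, 'e) qpath \<Rightarrow> 'v" where
  "path_src p \<equiv> fst p"

definition path_tgt :: "('v, 'e) pre_digraph \<Rightarrow> ('v, 'e) qpath \<Rightarrow> 'v" where
  "path_tgt Q p = pre_digraph.awlast Q (fst p) (snd p)"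

abbreviation path_len :: "('v, 'e) qpath \<Rightarrow> nat" where
  "path_len p \<equiv> length (snd p)"

abbreviation trivial_path :: "'v \<Rightarrow> ('v, 'e) qpath" where
  "trivial_path h \<equiv> (h, [])"

abbreviation arrow_path :: "('v, 'e) pre_digraph \<Rightarrow> 'e \<Rightarrow> ('v, 'e) qpath" where
  "arrow_path Q a \<equiv> (tail Q a, [a])"

definition path_prod :: "('v, 'e) pre_digraph \<Rightarrow> ('v, 'e) qpath \<Rightarrow> ('v, 'e) qpath \<Rightarrow> ('v, 'e) qpath \<Rightarrow> bool" where
  \<comment> \<open>\<open>p\<close> and \<open>q\<close> are composable paths and \<open>r\<close> is the path \<open>pq\<close>\<close>
  "path_prod Q p q r \<longleftrightarrow> p \<in> paths Q \<and> q \<in> paths Q \<and> path_tgt Q p = path_src q \<and>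
     r = (path_src p, snd p @ snd q)"

definition oriented_cycle :: "('v, 'e) pre_digraph \<Rightarrow> ('v, 'e) qpath \<Rightarrow> bool" where
  "oriented_cycle Q c \<longleftrightarrow> c \<in> paths Q \<and> 1 \<le> path_len c \<and> path_tgt Q c = path_src c"

section \<open>Algebras over a field\<close>

text \<open>The field is a type \<open>'k\<close> of class \<^class>\<open>field\<close>; an algebra over it is a
  \<^type>\<open>module_scheme\<close> record, i.e. a (not necessarily commutative) ring record
  together with a scalar multiplication.\<close>

definition quotient_algebra :: "('k, 'b) module \<Rightarrow> 'b set \<Rightarrow> ('k, 'b set) module" where
  "quotient_algebra A I =
     \<lparr>carrier = carrier (A Quot I), mult = mult (A Quot I), one = one (A Quot I),
      zero = zero (A Quot I), add = add (A Quot I),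
      smult = (\<lambda>c X. \<Union>x\<in>X. I +>\<^bsub>A\<^esub> (c \<odot>\<^bsub>A\<^esub> x))\<rparr>"

definition algebra_hom :: "('k, 'b) module \<Rightarrow> ('k, 'c) module \<Rightarrow> ('b \<Rightarrow> 'c) set" where
  "algebra_hom A B = {h \<in> ring_hom A B. \<forall>c. \<forall>x\<in>carrier A. h (c \<odot>\<^bsub>A\<^esub> x) = c \<odot>\<^bsub>B\<^esub> h x}"

definition lin_indep :: "('k::field, 'b) module \<Rightarrow> 'b set \<Rightarrow> bool" where
  "lin_indep A B \<longleftrightarrow> B \<subseteq> carrier A \<and>
     (\<forall>F c. finite F \<and> F \<subseteq> B \<and> (\<Oplus>\<^bsub>A\<^esub>b\<in>F. c b \<odot>\<^bsub>A\<^esub> b) = \<zero>\<^bsub>A\<^esub> \<longrightarrow> (\<forall>b\<in>F. c b = 0))"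

definition lin_span :: "('k::field, 'b) module \<Rightarrow> 'b set \<Rightarrow> 'b set" where
  "lin_span A B = {(\<Oplus>\<^bsub>A\<^esub>b\<in>F. c b \<odot>\<^bsub>A\<^esub> b) | F c. finite F \<and> F \<subseteq> B}"

definition is_basis :: "('k::field, 'b) module \<Rightarrow> 'b set \<Rightarrow> 'b set \<Rightarrow> bool" where
  "is_basis A S B \<longleftrightarrow> lin_indep A B \<and> lin_span A B = S"

definition alg_dim :: "('k::field, 'b) module \<Rightarrow> nat" where
  \<comment> \<open>0 if there is no finite basis\<close>
  "alg_dim A = (if \<exists>B. is_basis A (carrier A) B then card (SOME B. is_basis A (carrier A) B) else 0)"

definition sub_bimodule :: "('k, 'b) module \<Rightarrow> 'b set \<Rightarrow> bool" where
  "sub_bimodule A I \<longleftrightarrow> ideal I A \<and> (\<forall>c. \<forall>x\<in>I. c \<odot>\<^bsub>A\<^esub> x \<in> I)"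

definition simple_sub_bimodule :: "('k, 'b) module \<Rightarrow> 'b set \<Rightarrow> bool" where
  "simple_sub_bimodule A S \<longleftrightarrow> sub_bimodule A S \<and> S \<noteq> {\<zero>\<^bsub>A\<^esub>} \<and>
     (\<forall>J. sub_bimodule A J \<and> J \<subseteq> S \<longrightarrow> J = {\<zero>\<^bsub>A\<^esub>} \<or> J = S)"

definition bimodule_socle :: "('k, 'b) module \<Rightarrow> 'b set" where
  \<comment> \<open>the sum of the simple sub-bimodules, as the least sub-bimodule that contains them\<close>
  "bimodule_socle A = \<Inter>{I. sub_bimodule A I \<and> \<Union>{S. simple_sub_bimodule A S} \<subseteq> I}"

subsection \<open>The dual bimodule\<close>

text \<open>A functional on \<open>A\<close> is a total function that is made unique by the value 0 outside the carrier.\<close>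

definition dual_space :: "('k::field, 'b) module \<Rightarrow> ('b \<Rightarrow> 'k) set" where
  "dual_space A = {f.
     (\<forall>x\<in>carrier A. \<forall>y\<in>carrier A. f (x \<oplus>\<^bsub>A\<^esub> y) = f x + f y) \<and>
     (\<forall>c. \<forall>x\<in>carrier A. f (c \<odot>\<^bsub>A\<^esub> x) = c * f x) \<and>
     (\<forall>x. x \<notin> carrier A \<longrightarrow> f x = 0)}"

definition dual_lact :: "('k::field, 'b) module \<Rightarrow> 'b \<Rightarrow> ('b \<Rightarrow> 'k) \<Rightarrow> 'b \<Rightarrow> 'k" where
  "dual_lact A a f = (\<lambda>x. if x \<in> carrier A then f (x \<otimes>\<^bsub>A\<^esub> a) else 0)"

definition dual_ract :: "('k::field, 'b) module \<Rightarrow> ('b \<Rightarrow> 'k) \<Rightarrow> 'b \<Rightarrow> 'b \<Rightarrow> 'k" where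
  "dual_ract A f b = (\<lambda>x. if x \<in> carrier A then f (b \<otimes>\<^bsub>A\<^esub> x) else 0)"

definition dual_vector :: "('k::field, 'b) module \<Rightarrow> 'b set \<Rightarrow> 'b \<Rightarrow> 'b \<Rightarrow> 'k" where
  \<comment> \<open>the element \<open>b\<^sup>*\<close> of the basis dual to the basis \<open>B\<close> of \<open>A\<close>\<close>
  "dual_vector A B b =
     (THE f. f \<in> dual_space A \<and> (\<forall>b'\<in>B. f b' = (if b' = b then 1 else 0)))"

definition hochschild_extension ::
    "('k::field, 'b) module \<Rightarrow> ('b \<Rightarrow> 'b \<Rightarrow> 'b \<Rightarrow> 'k) \<Rightarrow> ('k, 'b \<times> ('b \<Rightarrow> 'k)) module" where
  \<comment> \<open>the identity is \<open>(1, -\<alpha>(1, 1))\<close> because the 2-cocycle \<open>\<alpha>\<close> need not be normalized\<close>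
  "hochschild_extension A \<alpha> =
     \<lparr>carrier = carrier A \<times> dual_space A,
      mult = (\<lambda>(a, f) (b, g). (a \<otimes>\<^bsub>A\<^esub> b,
        \<lambda>x. dual_lact A a g x + dual_ract A f b x + \<alpha> a b x)),
      one = (\<one>\<^bsub>A\<^esub>, \<lambda>x. - \<alpha> \<one>\<^bsub>A\<^esub> \<one>\<^bsub>A\<^esub> x),
      zero = (\<zero>\<^bsub>A\<^esub>, \<lambda>x. 0),
      add = (\<lambda>(a, f) (b, g). (a \<oplus>\<^bsub>A\<^esub> b, \<lambda>x. f x + g x)),
      smult = (\<lambda>c (a, f). (c \<odot>\<^bsub>A\<^esub> a, \<lambda>x. c * f x))\<rparr>"

section \<open>Path algebras and truncated quiver algebras\<close>

definition path_algebra :: "('v, 'e) pre_digraph \<Rightarrow> ('k::field, ('v, 'e) qpath \<Rightarrow> 'k) module" where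
  "path_algebra Q =
     \<lparr>carrier = {f. finite {p. f p \<noteq> 0} \<and> {p. f p \<noteq> 0} \<subseteq> paths Q},
      mult = (\<lambda>f g r. \<Sum>(p, q) \<in> {(p, q). path_prod Q p q r}. f p * g q),
      one = (\<lambda>p. if p \<in> paths Q \<and> path_len p = 0 then 1 else 0),
      zero = (\<lambda>p. 0),
      add = (\<lambda>f g p. f p + g p),
      smult = (\<lambda>c f p. c * f p)\<rparr>"

definition path_elem :: "('v, 'e) qpath \<Rightarrow> ('v, 'e) qpath \<Rightarrow> 'k::field" where
  "path_elem p = (\<lambda>q. if q = p then 1 else 0)"

definition arrow_ideal :: "('v, 'e) pre_digraph \<Rightarrow> (('v, 'e) qpath \<Rightarrow> 'k::field) set" where
  "arrow_ideal Q = Idl\<^bsub>path_algebra Q\<^esub> ((\<lambda>a. path_elem (arrow_path Q a)) ` arcs Q)"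

definition arrow_ideal_power :: "('v, 'e) pre_digraph \<Rightarrow> nat \<Rightarrow> (('v, 'e) qpath \<Rightarrow> 'k::field) set" where
  "arrow_ideal_power Q n = arrow_ideal Q [^]\<^bsub>ideals_set (path_algebra Q)\<^esub> n"

definition truncated_algebra ::
    "('v, 'e) pre_digraph \<Rightarrow> nat \<Rightarrow> ('k::field, (('v, 'e) qpath \<Rightarrow> 'k) set) module" where
  "truncated_algebra Q n = quotient_algebra (path_algebra Q) (arrow_ideal_power Q n)"

definition path_class :: "('v, 'e) pre_digraph \<Rightarrow> nat \<Rightarrow> ('v, 'e) qpath \<Rightarrow> (('v, 'e) qpath \<Rightarrow> 'k::field) set" where
  "path_class Q n p = arrow_ideal_power Q n +>\<^bsub>path_algebra Q\<^esub> path_elem p"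

definition basis_paths :: "('v, 'e) pre_digraph \<Rightarrow> nat \<Rightarrow> ('v, 'e) qpath set" where
  "basis_paths Q n = {p \<in> paths Q. path_len p < n}"

definition dual_path ::
    "('v, 'e) pre_digraph \<Rightarrow> nat \<Rightarrow> ('v, 'e) qpath \<Rightarrow> (('v, 'e) qpath \<Rightarrow> 'k::field) set \<Rightarrow> 'k" where
  \<comment> \<open>the functional \<open>p\<^sup>*\<close> for a path \<open>p\<close> of length less than \<open>n\<close>\<close>
  "dual_path Q n p =
     dual_vector (truncated_algebra Q n) (path_class Q n ` basis_paths Q n) (path_class Q n p)"

section \<open>The cocycle of an oriented cycle\<close>

definition cycle_arrow :: "('v, 'e) qpath \<Rightarrow> nat \<Rightarrow> 'e" where
  "cycle_arrow \<gamma> i = snd \<gamma> ! (i mod path_len \<gamma>)"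

definition cycle_segment :: "('v, 'e) pre_digraph \<Rightarrow> ('v, 'e) qpath \<Rightarrow> nat \<Rightarrow> nat \<Rightarrow> ('v, 'e) qpath" where
  \<comment> \<open>the path of length \<open>m\<close> along the cycle \<open>\<gamma>\<close> that starts with its \<open>i\<close>-th arrow;
    arrows are counted from 0, modulo the length of \<open>\<gamma>\<close>\<close>
  "cycle_segment Q \<gamma> i m = (tail Q (cycle_arrow \<gamma> i), map (cycle_arrow \<gamma>) [i..<i + m])"

definition cocycle_on_paths ::
    "('v, 'e) pre_digraph \<Rightarrow> nat \<Rightarrow> ('v, 'e) qpath \<Rightarrow> nat \<Rightarrow> ('v, 'e) qpath \<Rightarrow> ('v, 'e) qpath
      \<Rightarrow> (('v, 'e) qpath \<Rightarrow> 'k::field) set \<Rightarrow> 'k" where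
  "cocycle_on_paths Q n \<gamma> i a b =
     (let s = path_len \<gamma>; m = path_len a + path_len b in
      if n \<le> m \<and> m < s \<and> path_prod Q a b (cycle_segment Q \<gamma> i m)
        then dual_path Q n (cycle_segment Q \<gamma> (i + m) (s - m))
      else if path_prod Q a b (cycle_segment Q \<gamma> i s)
        then dual_path Q n (trivial_path (tail Q (cycle_arrow \<gamma> i)))
      else (\<lambda>_. 0))"

definition cocycle_summand ::
    "('v, 'e) pre_digraph \<Rightarrow> nat \<Rightarrow> ('v, 'e) qpath \<Rightarrow> nat
      \<Rightarrow> (('v, 'e) qpath \<Rightarrow> 'k::field) set \<Rightarrow> (('v, 'e) qpath \<Rightarrow> 'k) set \<Rightarrow> (('v, 'e) qpath \<Rightarrow> 'k) set \<Rightarrow> 'k" where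
  \<comment> \<open>the bilinear extension: \<open>p\<^sup>*(x)\<close> is the coordinate of \<open>x\<close> at the class of \<open>p\<close>\<close>
  "cocycle_summand Q n \<gamma> i x y =
     (\<lambda>z. \<Sum>a\<in>basis_paths Q n. \<Sum>b\<in>basis_paths Q n.
        dual_path Q n a x * dual_path Q n b y * cocycle_on_paths Q n \<gamma> i a b z)"

definition cocycle ::
    "('v, 'e) pre_digraph \<Rightarrow> nat \<Rightarrow> ('v, 'e) qpath \<Rightarrow> 'k::field
      \<Rightarrow> (('v, 'e) qpath \<Rightarrow> 'k) set \<Rightarrow> (('v, 'e) qpath \<Rightarrow> 'k) set \<Rightarrow> (('v, 'e) qpath \<Rightarrow> 'k) set \<Rightarrow> 'k" where
  "cocycle Q n \<gamma> k x y = (\<lambda>z. k * (\<Sum>i<path_len \<gamma>. cocycle_summand Q n \<gamma> i x y z))"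

section \<open>The extension algebra, its quiver and its cycles\<close>

definition extension_algebra ::
    "('v, 'e) pre_digraph \<Rightarrow> nat \<Rightarrow> ('v, 'e) qpath \<Rightarrow> 'k::field
      \<Rightarrow> ('k, (('v, 'e) qpath \<Rightarrow> 'k) set \<times> ((('v, 'e) qpath \<Rightarrow> 'k) set \<Rightarrow> 'k)) module" where
  "extension_algebra Q n \<gamma> k = hochschild_extension (truncated_algebra Q n) (cocycle Q n \<gamma> k)"

definition extension_quiver ::
    "('v, 'e) pre_digraph \<Rightarrow> ('v, 'e) qpath set \<Rightarrow> ('v, 'e + ('v, 'e) qpath) pre_digraph" where
  \<comment> \<open>\<open>Inr p\<close> is the new arrow \<open>y\<^sub>p\<close>\<close>
  "extension_quiver Q M =
     \<lparr>verts = verts Q, arcs = Inl ` arcs Q \<union> Inr ` M,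
      tail = case_sum (tail Q) (path_tgt Q), head = case_sum (head Q) path_src\<rparr>"

definition is_presentation ::
    "('v, 'e) pre_digraph \<Rightarrow> nat \<Rightarrow> ('v, 'e) qpath set \<Rightarrow> ('v, 'e) qpath \<Rightarrow> 'k::field
      \<Rightarrow> ((('v, 'e + ('v, 'e) qpath) qpath \<Rightarrow> 'k)
          \<Rightarrow> (('v, 'e) qpath \<Rightarrow> 'k) set \<times> ((('v, 'e) qpath \<Rightarrow> 'k) set \<Rightarrow> 'k)) \<Rightarrow> bool" where
  \<comment> \<open>\<open>\<Phi>\<close> is determined on the path algebra, since vertices and arrows generate it\<close>
  "is_presentation Q n M \<gamma> k \<Phi> \<longleftrightarrow>
     \<Phi> \<in> algebra_hom (path_algebra (extension_quiver Q M)) (extension_algebra Q n \<gamma> k) \<and>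
     (\<forall>h\<in>verts Q. \<Phi> (path_elem (trivial_path h)) = (path_class Q n (trivial_path h), \<lambda>_. 0)) \<and>
     (\<forall>a\<in>arcs Q. \<Phi> (path_elem (arrow_path (extension_quiver Q M) (Inl a)))
        = (path_class Q n (arrow_path Q a), \<lambda>_. 0)) \<and>
     (\<forall>p\<in>M. \<Phi> (path_elem (arrow_path (extension_quiver Q M) (Inr p)))
        = (\<zero>\<^bsub>truncated_algebra Q n\<^esub>, dual_path Q n p))"

definition elementary_cycle ::
    "'k::field itself \<Rightarrow> ('v, 'e) pre_digraph \<Rightarrow> nat \<Rightarrow> ('v, 'e) qpath set
      \<Rightarrow> ('v, 'e + ('v, 'e) qpath) qpath \<Rightarrow> bool" where
  "elementary_cycle (_ :: 'k itself) Q n M C \<longleftrightarrow> oriented_cycle (extension_quiver Q M) C \<and>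
     (\<exists>\<delta>1 \<delta>2 p d. p \<in> M \<and> \<delta>1 \<in> paths Q \<and> \<delta>2 \<in> paths Q \<and>
        path_tgt Q \<delta>2 = path_tgt Q p \<and> path_src \<delta>1 = path_src p \<and>
        C = (path_src \<delta>2, map Inl (snd \<delta>2) @ [Inr p] @ map Inl (snd \<delta>1)) \<and>
        path_prod Q \<delta>1 \<delta>2 d \<and> dual_path Q n p (path_class Q n d) \<noteq> (0 :: 'k))"

definition revived_cycle ::
    "('v, 'e) pre_digraph \<Rightarrow> nat \<Rightarrow> ('v, 'e) qpath set \<Rightarrow> ('v, 'e) qpath \<Rightarrow> 'k::field
      \<Rightarrow> ('v, 'e + ('v, 'e) qpath) qpath \<Rightarrow> bool" where
  "revived_cycle Q n M \<gamma> k C \<longleftrightarrow> oriented_cycle (extension_quiver Q M) C \<and>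
     (\<exists>a b c. C = (path_src c, map Inl (snd c)) \<and> path_prod Q a b c \<and>
        1 \<le> path_len a \<and> 1 \<le> path_len b \<and>
        path_class Q n a \<noteq> \<zero>\<^bsub>truncated_algebra Q n :: ('k, _) module\<^esub> \<and>
        path_class Q n b \<noteq> \<zero>\<^bsub>truncated_algebra Q n :: ('k, _) module\<^esub> \<and>
        cocycle Q n \<gamma> k (path_class Q n a) (path_class Q n b) \<noteq> (\<lambda>_. 0))"

end

theory Submission
  imports Defs
begin

text \<open>The ideal \<open>R\<^sup>n\<close> consists of the combinations of paths of length at least \<open>n\<close>, so the coefficient
  of a path of length less than \<open>n\<close> is well defined on \<open>A\<close>, and it is the dual basis vector of that
  path. Since \<open>D(A)\<close> squares to zero in \<open>T\<^sub>\<alpha>(A)\<close>, a cycle with at least two new arrows vanishes.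
  A cycle \<open>\<delta>\<^sub>2 y\<^sub>p \<delta>\<^sub>1\<close> with exactly one new arrow is mapped to \<open>(0, x \<mapsto> p\<^sup>*(\<delta>\<^sub>1 x \<delta>\<^sub>2))\<close>. A path \<open>x\<close> on
  which this does not vanish is closed and shorter than \<open>n\<close>, hence trivial because all oriented
  cycles have length at least \<open>n\<close>; so the cycle is elementary. A cycle \<open>c\<close> without new arrows has
  length at least \<open>n\<close>. If its length is at most \<open>2n - 2\<close>, it splits into two paths \<open>a\<close>, \<open>b\<close> of length
  less than \<open>n\<close> and is mapped to \<open>(0, \<alpha>(a, b))\<close>. If it is longer, its prefix of length \<open>2n - 2\<close> is mapped to
  a combination of the functionals \<open>e\<^sup>*\<close> of trivial paths, which the next arrow annihilates.\<close>

section \<open>The path algebra\<close>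

lemma path_algebra_sel:
  "carrier (path_algebra Q) = {f. finite {p. f p \<noteq> 0} \<and> {p. f p \<noteq> 0} \<subseteq> paths Q}"
  "mult (path_algebra Q) = (\<lambda>f g r. \<Sum>(p, q) \<in> {(p, q). path_prod Q p q r}. f p * g q)"
  "one (path_algebra Q) = (\<lambda>p. if p \<in> paths Q \<and> path_len p = 0 then 1 else 0)"
  "zero (path_algebra Q) = (\<lambda>p. 0)"
  "add (path_algebra Q) = (\<lambda>f g p. f p + g p)"
  "smult (path_algebra Q) = (\<lambda>c f p. c * f p)"
  by (simp_all add: path_algebra_def)

text \<open>A factorization of \<open>r\<close> is determined by the place where \<open>r\<close> is
  cut. Finiteness matters because \<open>sum\<close> over an infinite set is 0 by
  convention.\<close>

lemma finite_path_prod: "finite {(p, q). path_prod Q p q r}"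
proof (rule finite_subset)
  let ?f = "\<lambda>i. ((fst r, take i (snd r)), (path_tgt Q (fst r, take i (snd r)), drop i (snd r)))"
  show "{(p, q). path_prod Q p q r} \<subseteq> ?f ` {..length (snd r)}"
  proof clarify
    fix u w u' w' assume "path_prod Q (u, w) (u', w') r"
    then have "((u, w), (u', w')) = ?f (length w)" "length w \<le> length (snd r)"
      by (auto simp: path_prod_def)
    then show "((u, w), (u', w')) \<in> ?f ` {..length (snd r)}" by blast
  qed
qed simp

lemma path_algebra_mult_path_elem:
  assumes "path_prod Q p q r"
  shows "path_elem p \<otimes>\<^bsub>path_algebra Q\<^esub> path_elem q = (path_elem r :: _ \<Rightarrow> 'k::field)"
proof
  fix r'
  have "(\<Sum>(p', q') \<in> {(p', q'). path_prod Q p' q' r'}. path_elem p p' * path_elem q q' :: 'k)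
      = (\<Sum>x \<in> {(p', q'). path_prod Q p' q' r'}. if x = (p, q) then 1 else 0)"
    by (rule sum.cong) (auto simp: path_elem_def split: if_splits)
  also have "\<dots> = (if path_prod Q p q r' then 1 else 0)"
    by (simp add: finite_path_prod)
  \<comment> \<open>A composable pair has only one product.\<close>
  also have "path_prod Q p q r' \<longleftrightarrow> r' = r"
    using assms by (auto simp: path_prod_def)
  finally show "(path_elem p \<otimes>\<^bsub>path_algebra Q\<^esub> path_elem q) r' = (path_elem r r' :: 'k)"
    by (simp add: path_algebra_sel path_elem_def)
qed

text \<open>Turns questions about the support of a product into questions about factorizations of
  paths, without reopening the convolution sum.\<close>

lemma path_algebra_mult_nonzeroE:
  assumes "(f \<otimes>\<^bsub>path_algebra Q\<^esub> g) r \<noteq> 0"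
  obtains p q where "path_prod Q p q r" "f p \<noteq> 0" "g q \<noteq> 0"
proof -
  from assms obtain x where "x \<in> {(p, q). path_prod Q p q r}" "(case x of (p, q) \<Rightarrow> f p * g q) \<noteq> 0"
    unfolding path_algebra_sel by (meson sum.not_neutral_contains_not_neutral)
  then show ?thesis using that by (cases x) auto
qed

lemma path_elem_carrier: "p \<in> paths Q \<Longrightarrow> path_elem p \<in> carrier (path_algebra Q)"
  by (auto simp: path_algebra_sel path_elem_def split: if_splits)

section \<open>Factorizations of paths and the ring axioms of the path algebra\<close>

context wf_digraph
begin

lemma paths_iff: "p \<in> paths G \<longleftrightarrow> awalk (fst p) (snd p) (path_tgt G p)"
  by (cases p) (auto simp: paths_def path_tgt_def)

lemma trivial_path_in_paths: "v \<in> verts G \<Longrightarrow> trivial_path v \<in> paths G"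
  by (simp add: paths_iff path_tgt_def awalk_Nil_iff)

lemma arrow_path_in_paths: "a \<in> arcs G \<Longrightarrow> arrow_path G a \<in> paths G"
  by (simp add: paths_iff path_tgt_def awalk_simps)

lemma path_src_in_verts: "p \<in> paths G \<Longrightarrow> fst p \<in> verts G"
  by (auto simp: paths_iff)

lemma path_tgt_in_verts: "p \<in> paths G \<Longrightarrow> path_tgt G p \<in> verts G"
  by (auto simp: paths_iff)

text \<open>Initial and final pieces of a path are again paths, so it suffices that the whole of
  \<open>r\<close> is a path and that the second factor starts where the first one ends.\<close>

lemma path_prod_iff:
  "path_prod G p q r \<longleftrightarrow>
    r \<in> paths G \<and> fst p = fst r \<and> snd r = snd p @ snd q \<and> fst q = path_tgt G p"
proof (cases p; cases q; cases r)
  fix u v w x y z assume "p = (u, v)" "q = (w, x)" "r = (y, z)"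
  then show ?thesis
    by (auto simp: path_prod_def paths_iff path_tgt_def awlast_append)
qed

lemma path_tgt_prod: "path_prod G p q r \<Longrightarrow> path_tgt G r = path_tgt G q"
  by (auto simp: path_prod_def path_tgt_def awlast_append)

lemma path_prod_take_drop:
  assumes "r \<in> paths G"
  shows "path_prod G (fst r, take i (snd r)) (path_tgt G (fst r, take i (snd r)), drop i (snd r)) r"
  using assms by (simp add: path_prod_iff)

lemma path_prod_trivial_left_iff: "path_prod G (v, []) q r \<longleftrightarrow> r \<in> paths G \<and> v = fst r \<and> q = r"
  by (cases q; cases r) (auto simp: path_prod_iff path_tgt_def)

lemma path_prod_trivial_right_iff:
  "path_prod G p (v, []) r \<longleftrightarrow> r \<in> paths G \<and> v = path_tgt G r \<and> p = r"
  by (cases p; cases r) (auto simp: path_prod_iff path_tgt_def)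

lemma path_algebra_mult_closed:
  assumes f: "f \<in> carrier (path_algebra G)" and g: "g \<in> carrier (path_algebra G)"
  shows "f \<otimes>\<^bsub>path_algebra G\<^esub> g \<in> carrier (path_algebra G)"
proof -
  have nz: "\<exists>p q. path_prod G p q r \<and> f p \<noteq> 0 \<and> g q \<noteq> 0"
    if "(f \<otimes>\<^bsub>path_algebra G\<^esub> g) r \<noteq> 0" for r
    using that by (blast elim: path_algebra_mult_nonzeroE)
  have "{r. (f \<otimes>\<^bsub>path_algebra G\<^esub> g) r \<noteq> 0}
      \<subseteq> (\<lambda>(p, q). (fst p, snd p @ snd q)) ` ({p. f p \<noteq> 0} \<times> {p. g p \<noteq> 0})"
  proof
    fix r assume "r \<in> {r. (f \<otimes>\<^bsub>path_algebra G\<^esub> g) r \<noteq> 0}"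
    then obtain p q where "path_prod G p q r" "f p \<noteq> 0" "g q \<noteq> 0" using nz by blast
    then show "r \<in> (\<lambda>(p, q). (fst p, snd p @ snd q)) ` ({p. f p \<noteq> 0} \<times> {p. g p \<noteq> 0})"
      by (intro image_eqI[of _ _ "(p, q)"]) (auto simp: path_prod_def)
  qed
  moreover have "finite \<dots>" using f g by (simp add: path_algebra_sel)
  ultimately have "finite {r. (f \<otimes>\<^bsub>path_algebra G\<^esub> g) r \<noteq> 0}" by (rule finite_subset)
  moreover have "{r. (f \<otimes>\<^bsub>path_algebra G\<^esub> g) r \<noteq> 0} \<subseteq> paths G"
    using nz by (auto simp: path_prod_iff)
  ultimately show ?thesis by (simp add: path_algebra_sel(1))
qed

lemma path_algebra_mult_assoc:
  "(f \<otimes>\<^bsub>path_algebra G\<^esub> g) \<otimes>\<^bsub>path_algebra G\<^esub> h = f \<otimes>\<^bsub>path_algebra G\<^esub> (g \<otimes>\<^bsub>path_algebra G\<^esub> h)"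
proof
  fix r
  let ?S = "\<lambda>r. {(p, q). path_prod G p q r}"
  have "((f \<otimes>\<^bsub>path_algebra G\<^esub> g) \<otimes>\<^bsub>path_algebra G\<^esub> h) r
      = (\<Sum>x \<in> ?S r. \<Sum>y \<in> ?S (fst x). f (fst y) * g (snd y) * h (snd x))"
    by (simp add: path_algebra_sel case_prod_unfold sum_distrib_right)
  also have "\<dots> = (\<Sum>(x, y) \<in> Sigma (?S r) (\<lambda>x. ?S (fst x)). f (fst y) * g (snd y) * h (snd x))"
    by (rule sum.Sigma) (simp_all add: finite_path_prod)
  \<comment> \<open>Both sides run over the factorizations of \<open>r\<close> into three paths;
    \<open>i\<close> and \<open>j\<close> move the bracket from one side to the other.\<close>
  also have "\<dots> = (\<Sum>(x, y) \<in> Sigma (?S r) (\<lambda>x. ?S (snd x)). f (fst x) * (g (fst y) * h (snd y)))"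
    by (rule sum.reindex_bij_witness
        [where i = "\<lambda>((p, q), (q1, q2)). (((fst p, snd p @ snd q1), q2), (p, q1))"
           and j = "\<lambda>((p, q), (p1, p2)). ((p1, (fst p2, snd p2 @ snd q)), (p2, q))"])
      (auto simp: path_prod_def path_tgt_def paths_iff awlast_append mult.assoc)
  also have "\<dots> = (\<Sum>x \<in> ?S r. \<Sum>y \<in> ?S (snd x). f (fst x) * (g (fst y) * h (snd y)))"
    by (rule sum.Sigma [symmetric]) (simp_all add: finite_path_prod)
  also have "\<dots> = (f \<otimes>\<^bsub>path_algebra G\<^esub> (g \<otimes>\<^bsub>path_algebra G\<^esub> h)) r"
    by (simp add: path_algebra_sel case_prod_unfold sum_distrib_left)
  finally show "((f \<otimes>\<^bsub>path_algebra G\<^esub> g) \<otimes>\<^bsub>path_algebra G\<^esub> h) r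
    = (f \<otimes>\<^bsub>path_algebra G\<^esub> (g \<otimes>\<^bsub>path_algebra G\<^esub> h)) r" .
qed

lemma path_algebra_one_mult:
  assumes "f \<in> carrier (path_algebra G)"
  shows "\<one>\<^bsub>path_algebra G\<^esub> \<otimes>\<^bsub>path_algebra G\<^esub> f = f"
proof
  fix r
  have "(\<one>\<^bsub>path_algebra G\<^esub> \<otimes>\<^bsub>path_algebra G\<^esub> f) r
      = (\<Sum>x \<in> {(p, q). path_prod G p q r}. if x = ((fst r, []), r) then f r else 0)"
    unfolding path_algebra_sel
    by (rule sum.cong) (auto simp: path_prod_def paths_iff path_tgt_def awalk_Nil_iff split: if_splits)
  also have "\<dots> = (if r \<in> paths G then f r else 0)"
    by (simp add: finite_path_prod path_prod_trivial_left_iff)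
  also have "\<dots> = f r" using assms by (auto simp: path_algebra_sel)
  finally show "(\<one>\<^bsub>path_algebra G\<^esub> \<otimes>\<^bsub>path_algebra G\<^esub> f) r = f r" .
qed

lemma path_algebra_mult_one:
  assumes "f \<in> carrier (path_algebra G)"
  shows "f \<otimes>\<^bsub>path_algebra G\<^esub> \<one>\<^bsub>path_algebra G\<^esub> = f"
proof
  fix r
  have "(f \<otimes>\<^bsub>path_algebra G\<^esub> \<one>\<^bsub>path_algebra G\<^esub>) r
      = (\<Sum>x \<in> {(p, q). path_prod G p q r}. if x = (r, (path_tgt G r, [])) then f r else 0)"
    unfolding path_algebra_sel
    by (rule sum.cong) (auto simp: path_prod_def paths_iff path_tgt_def awalk_Nil_iff split: if_splits)
  also have "\<dots> = (if r \<in> paths G then f r else 0)"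
    by (simp add: finite_path_prod path_prod_trivial_right_iff)
  also have "\<dots> = f r" using assms by (auto simp: path_algebra_sel)
  finally show "(f \<otimes>\<^bsub>path_algebra G\<^esub> \<one>\<^bsub>path_algebra G\<^esub>) r = f r" .
qed

lemma path_algebra_add_closed:
  assumes "f \<in> carrier (path_algebra G)" and "g \<in> carrier (path_algebra G)"
  shows "(\<lambda>p. f p + g p) \<in> carrier (path_algebra G)"
proof -
  have "{p. f p + g p \<noteq> 0} \<subseteq> {p. f p \<noteq> 0} \<union> {p. g p \<noteq> 0}" by auto
  moreover have "finite ({p. f p \<noteq> 0} \<union> {p. g p \<noteq> 0})" "{p. f p \<noteq> 0} \<union> {p. g p \<noteq> 0} \<subseteq> paths G"
    using assms by (simp_all add: path_algebra_sel)
  ultimately show ?thesis unfolding path_algebra_sel using finite_subset by blast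
qed

lemma path_algebra_smult_closed:
  "f \<in> carrier (path_algebra G) \<Longrightarrow> (\<lambda>p. c * f p) \<in> carrier (path_algebra G)"
  by (cases "c = 0") (simp_all add: path_algebra_sel)

lemma path_algebra_uminus_closed:
  "f \<in> carrier (path_algebra G) \<Longrightarrow> (\<lambda>p. - f p) \<in> carrier (path_algebra G)"
  by (simp add: path_algebra_sel)

lemma path_algebra_zero_closed: "(\<lambda>p. 0) \<in> carrier (path_algebra G)"
  by (simp add: path_algebra_sel)

lemma path_algebra_smult_mult:
  "(\<lambda>p. c * f p) \<otimes>\<^bsub>path_algebra G\<^esub> g = (\<lambda>p. c * (f \<otimes>\<^bsub>path_algebra G\<^esub> g) p)"
  by (simp add: path_algebra_sel sum_distrib_left case_prod_unfold mult.assoc)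

text \<open>Builds \<open>f\<close> from its support, one path at a time. The new path satisfies
  \<open>f p \<noteq> 0\<close> for the fixed \<open>f\<close>, so whatever is known about the
  support of \<open>f\<close> remains available in the inductive step.\<close>

lemma path_algebra_induct [consumes 1, case_names zero add]:
  assumes f: "f \<in> carrier (path_algebra G)" and zero: "P (\<lambda>_. 0)"
    and add: "\<And>g c p. g \<in> carrier (path_algebra G) \<Longrightarrow> P g \<Longrightarrow> f p \<noteq> 0 \<Longrightarrow>
      P (\<lambda>q. g q + c * path_elem p q)"
  shows "P f"
proof -
  have "P (\<lambda>q. if q \<in> F then f q else 0)" if "finite F" "F \<subseteq> {p. f p \<noteq> 0}" for F
    using that
  proof (induction F rule: finite_induct)
    case empty
    then show ?case using zero by simp
  next
    case (insert p F)
    let ?g = "\<lambda>q. if q \<in> F then f q else 0"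
    have "?g \<in> carrier (path_algebra G)"
      using f insert by (auto simp: path_algebra_sel)
    then have "P (\<lambda>q. ?g q + f p * path_elem p q)"
      using insert by (intro add) auto
    also have "(\<lambda>q. ?g q + f p * path_elem p q) = (\<lambda>q. if q \<in> insert p F then f q else 0)"
      using insert.hyps by (auto simp: path_elem_def)
    finally show ?case .
  qed
  from this[OF _ order_refl] have "P (\<lambda>q. if q \<in> {p. f p \<noteq> 0} then f q else 0)"
    using f unfolding path_algebra_sel by blast
  also have "(\<lambda>q. if q \<in> {p. f p \<noteq> 0} then f q else 0) = f" by auto
  finally show ?thesis .
qed

end

context fin_digraph
begin

text \<open>The unit is the sum of all trivial paths, and its support is finite because there are
  finitely many vertices.\<close>

lemma path_algebra_one_closed: "\<one>\<^bsub>path_algebra G\<^esub> \<in> carrier (path_algebra G)"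
proof -
  have "{p \<in> paths G. snd p = []} \<subseteq> trivial_path ` verts G"
    by (force simp: paths_iff)
  then have "finite {p \<in> paths G. snd p = []}" by (rule finite_subset) simp
  then show ?thesis by (auto simp: path_algebra_sel)
qed

lemma ring_path_algebra: "ring (path_algebra G :: ('k::field, _) module)"
proof (rule ringI)
  show "abelian_group (path_algebra G :: ('k, _) module)"
  proof (rule abelian_groupI)
    fix f :: "_ \<Rightarrow> 'k" assume "f \<in> carrier (path_algebra G)"
    then show "\<exists>g\<in>carrier (path_algebra G). g \<oplus>\<^bsub>path_algebra G\<^esub> f = \<zero>\<^bsub>path_algebra G\<^esub>"
      by (intro bexI[of _ "\<lambda>p. - f p"] path_algebra_uminus_closed) (simp_all add: path_algebra_sel)
  qed (use path_algebra_add_closed in \<open>auto simp: path_algebra_sel algebra_simps\<close>)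
  show "Group.monoid (path_algebra G :: ('k, _) module)"
    by (rule monoidI)
      (simp_all add: path_algebra_mult_closed path_algebra_one_closed path_algebra_mult_assoc
        path_algebra_one_mult path_algebra_mult_one)
qed (simp_all add: path_algebra_sel case_prod_unfold algebra_simps sum.distrib)

end

section \<open>The truncated algebra, its dual and the cocycle\<close>

definition long_elems :: "('v, 'e) pre_digraph \<Rightarrow> nat \<Rightarrow> (('v, 'e) qpath \<Rightarrow> 'k::field) set" where
  "long_elems Q n = {f \<in> carrier (path_algebra Q). \<forall>p. f p \<noteq> 0 \<longrightarrow> n \<le> path_len p}"

lemma long_elemsD:
  "f \<in> long_elems Q n \<Longrightarrow> f \<in> carrier (path_algebra Q)"
  "f \<in> long_elems Q n \<Longrightarrow> f p \<noteq> 0 \<Longrightarrow> n \<le> path_len p"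
  unfolding long_elems_def by blast+

lemma long_elemsI:
  "f \<in> carrier (path_algebra Q) \<Longrightarrow> (\<And>p. f p \<noteq> 0 \<Longrightarrow> n \<le> path_len p) \<Longrightarrow> f \<in> long_elems Q n"
  by (simp add: long_elems_def del: split_paired_All)

lemma path_elem_in_long_elems_iff:
  "p \<in> paths Q \<Longrightarrow> path_elem p \<in> (long_elems Q n :: (_ \<Rightarrow> 'k::field) set) \<longleftrightarrow> n \<le> path_len p"
  using long_elemsD(2)[of "path_elem p :: _ \<Rightarrow> 'k" Q n p]
  by (intro iffI long_elemsI path_elem_carrier) (auto simp: path_elem_def split: if_splits)

text \<open>Extends \<open>path_class\<close> from single paths to arbitrary representatives, so
  that computations in A can be done in the path algebra.\<close>

definition truncated_class ::
    "('v, 'e) pre_digraph \<Rightarrow> nat \<Rightarrow> (('v, 'e) qpath \<Rightarrow> 'k::field) \<Rightarrow> (('v, 'e) qpath \<Rightarrow> 'k) set" where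
  "truncated_class Q n f = arrow_ideal_power Q n +>\<^bsub>path_algebra Q\<^esub> f"

lemma path_class_eq: "path_class Q n p = truncated_class Q n (path_elem p)"
  by (simp add: path_class_def truncated_class_def)

context fin_digraph
begin

lemma path_algebra_a_inv:
  fixes f :: "_ \<Rightarrow> 'k::field"
  assumes "f \<in> carrier (path_algebra G)"
  shows "\<ominus>\<^bsub>path_algebra G\<^esub> f = (\<lambda>p. - f p)"
proof -
  interpret ring "path_algebra G :: ('k, _) module" by (rule ring_path_algebra)
  show ?thesis
    using path_algebra_uminus_closed[OF assms] assms
    by (intro minus_equality) (simp_all add: path_algebra_sel)
qed

lemma ideal_long_elems: "ideal (long_elems G n) (path_algebra G :: ('k::field, _) module)"
proof -
  interpret ring "path_algebra G :: ('k, _) module" by (rule ring_path_algebra)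
  show ?thesis
  proof (rule idealI[OF ring_path_algebra])
    show "subgroup (long_elems G n) (add_monoid (path_algebra G :: ('k, _) module))"
    proof (rule add.subgroupI)
      have "(\<lambda>_. 0) \<in> (long_elems G n :: (_ \<Rightarrow> 'k) set)"
        using path_algebra_zero_closed by (simp add: long_elems_def)
      then show "(long_elems G n :: (_ \<Rightarrow> 'k) set) \<noteq> {}" by blast
    next
      fix f :: "_ \<Rightarrow> 'k" assume "f \<in> long_elems G n"
      then show "\<ominus>\<^bsub>path_algebra G\<^esub> f \<in> long_elems G n"
        by (simp add: long_elems_def path_algebra_a_inv path_algebra_uminus_closed)
    next
      fix f g :: "_ \<Rightarrow> 'k" assume *: "f \<in> long_elems G n" "g \<in> long_elems G n"
      then have "(\<lambda>p. f p + g p) \<in> carrier (path_algebra G)"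
        by (simp add: long_elems_def path_algebra_add_closed)
      moreover have "n \<le> path_len p" if "f p + g p \<noteq> 0" for p
        using that * by (cases "f p = 0") (auto dest: long_elemsD(2))
      ultimately show "f \<oplus>\<^bsub>path_algebra G\<^esub> g \<in> long_elems G n"
        by (intro long_elemsI) (simp_all add: path_algebra_sel(5))
    qed (auto simp: long_elems_def)
  next
    fix f g :: "_ \<Rightarrow> 'k" assume *: "f \<in> long_elems G n" "g \<in> carrier (path_algebra G)"
    \<comment> \<open>Lengths add under composition, so multiplying by anything on either side can
      only lengthen the paths in the support of \<open>f\<close>.\<close>
    have "n \<le> path_len r" if "(f \<otimes>\<^bsub>path_algebra G\<^esub> g) r \<noteq> 0" for r
      using that
    proof (rule path_algebra_mult_nonzeroE)
      fix p q assume "path_prod G p q r" "f p \<noteq> 0"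
      then show ?thesis using * by (auto simp: path_prod_def dest: long_elemsD(2) intro: trans_le_add1)
    qed
    then show "f \<otimes>\<^bsub>path_algebra G\<^esub> g \<in> long_elems G n"
      using * by (intro long_elemsI path_algebra_mult_closed) (simp_all add: long_elemsD(1))
    have "n \<le> path_len r" if "(g \<otimes>\<^bsub>path_algebra G\<^esub> f) r \<noteq> 0" for r
      using that
    proof (rule path_algebra_mult_nonzeroE)
      fix p q assume "path_prod G p q r" "f q \<noteq> 0"
      then show ?thesis using * by (auto simp: path_prod_def dest: long_elemsD(2) intro: trans_le_add2)
    qed
    then show "g \<otimes>\<^bsub>path_algebra G\<^esub> f \<in> long_elems G n"
      using * by (intro long_elemsI path_algebra_mult_closed) (simp_all add: long_elemsD(1))
  qed
qed

text \<open>It suffices to place the paths in the support of \<open>f\<close> in \<open>I\<close>.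
  The point is scalars: \<open>ideal\<close> is a notion of rings and says nothing about
  \<open>smult\<close>.\<close>

lemma ideal_path_algebraI:
  fixes f :: "_ \<Rightarrow> 'k::field"
  assumes "ideal I (path_algebra G)" and "f \<in> carrier (path_algebra G)"
    and path_elem_in: "\<And>p. f p \<noteq> 0 \<Longrightarrow> path_elem p \<in> I"
  shows "f \<in> I"
proof -
  interpret ideal I "path_algebra G :: ('k, _) module" by fact
  show ?thesis
    using assms(2)
  proof (induction rule: path_algebra_induct)
    case zero
    show ?case
      using additive_subgroup.zero_closed[OF ideal.axioms(1)[OF assms(1)]] by (simp add: path_algebra_sel)
  next
    case (add g c p)
    \<comment> \<open>This is \<open>c\<close> times the unit; ring multiplication by it is scalar
      multiplication by \<open>c\<close>.\<close>
    let ?c = "\<lambda>q. c * \<one>\<^bsub>path_algebra G\<^esub> q"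
    have p: "path_elem p \<in> I" using add path_elem_in by blast
    have "?c \<otimes>\<^bsub>path_algebra G\<^esub> path_elem p \<in> I"
      by (rule I_l_closed[OF p]) (rule path_algebra_smult_closed, rule path_algebra_one_closed)
    then have "(\<lambda>q. c * path_elem p q) \<in> I"
      using Icarr[OF p] by (simp add: path_algebra_smult_mult path_algebra_one_mult)
    from additive_subgroup.a_closed[OF ideal.axioms(1)[OF assms(1)] add.IH this] show ?case by (simp add: path_algebra_sel)
  qed
qed

lemma arrow_ideal_eq: "arrow_ideal G = (long_elems G 1 :: (_ \<Rightarrow> 'k::field) set)"
proof -
  interpret ring "path_algebra G :: ('k, _) module" by (rule ring_path_algebra)
  let ?X = "(\<lambda>a. path_elem (arrow_path G a)) ` arcs G :: (_ \<Rightarrow> 'k) set"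
  have X: "?X \<subseteq> carrier (path_algebra G)"
    by (auto intro!: path_elem_carrier arrow_path_in_paths)
  interpret I: ideal "Idl\<^bsub>path_algebra G\<^esub> ?X" "path_algebra G :: ('k, _) module"
    by (rule genideal_ideal[OF X])
  show ?thesis unfolding arrow_ideal_def
  proof
    show "Idl\<^bsub>path_algebra G\<^esub> ?X \<subseteq> long_elems G 1"
      by (intro genideal_minimal ideal_long_elems)
        (auto simp: path_elem_in_long_elems_iff arrow_path_in_paths)
  next
    show "long_elems G 1 \<subseteq> Idl\<^bsub>path_algebra G\<^esub> ?X"
    proof
      fix f :: "_ \<Rightarrow> 'k" assume f: "f \<in> long_elems G 1"
      show "f \<in> Idl\<^bsub>path_algebra G\<^esub> ?X"
      proof (rule ideal_path_algebraI[OF I.is_ideal])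
        show "f \<in> carrier (path_algebra G)" using f by (simp add: long_elems_def)
        fix p assume "f p \<noteq> 0"
        then have "p \<in> paths G" "1 \<le> path_len p"
          using f long_elemsD[OF f] by (auto simp: path_algebra_sel)
        moreover obtain u w where "p = (u, w)" by (cases p)
        \<comment> \<open>A path of positive length is its first arrow times the rest, hence lies in
          the ideal generated by the arrows.\<close>
        ultimately obtain a w' where p: "(u, a # w') \<in> paths G" "p = (u, a # w')"
          by (cases w) auto
        then have a: "a \<in> arcs G" and prod: "path_prod G (arrow_path G a) (head G a, w') p"
          by (auto simp: path_prod_iff paths_iff path_tgt_def awalk_simps)
        have "path_elem (arrow_path G a) \<in> Idl\<^bsub>path_algebra G\<^esub> ?X"
          using genideal_self[OF X] a by blast
        moreover have "path_elem (head G a, w') \<in> carrier (path_algebra G)"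
          using prod by (intro path_elem_carrier) (simp add: path_prod_def)
        ultimately show "path_elem p \<in> Idl\<^bsub>path_algebra G\<^esub> ?X"
          using I.I_r_closed by (simp flip: path_algebra_mult_path_elem[OF prod])
      qed
    qed
  qed
qed

lemma ideal_prod_long_elems:
  "ideal_prod (path_algebra G) (long_elems G m) (long_elems G n) = (long_elems G (m + n) :: (_ \<Rightarrow> 'k::field) set)"
proof
  interpret J: ideal "long_elems G (m + n)" "path_algebra G :: ('k, _) module"
    by (rule ideal_long_elems)
  show "ideal_prod (path_algebra G) (long_elems G m) (long_elems G n) \<subseteq> (long_elems G (m + n) :: (_ \<Rightarrow> 'k) set)"
  proof
    fix f :: "_ \<Rightarrow> 'k" assume "f \<in> ideal_prod (path_algebra G) (long_elems G m) (long_elems G n)"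
    then show "f \<in> long_elems G (m + n)"
    proof induction
      case (prod i j)
      have "i \<otimes>\<^bsub>path_algebra G\<^esub> j \<in> carrier (path_algebra G)"
        by (rule path_algebra_mult_closed[OF long_elemsD(1)[OF prod(1)] long_elemsD(1)[OF prod(2)]])
      moreover have "m + n \<le> path_len r" if "(i \<otimes>\<^bsub>path_algebra G\<^esub> j) r \<noteq> 0" for r
      proof -
        from that obtain p q where *: "path_prod G p q r" "i p \<noteq> 0" "j q \<noteq> 0"
          by (rule path_algebra_mult_nonzeroE)
        then have "m \<le> path_len p" "n \<le> path_len q" using long_elemsD(2)[OF prod(1)] long_elemsD(2)[OF prod(2)] by blast+
        with * show ?thesis by (auto simp: path_prod_def)
      qed
      ultimately show ?case by (rule long_elemsI)
    next
      case (sum s1 s2)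
      then show ?case using J.a_closed by blast
    qed
  qed
next
  interpret ring "path_algebra G :: ('k, _) module" by (rule ring_path_algebra)
  show "long_elems G (m + n) \<subseteq> (ideal_prod (path_algebra G) (long_elems G m) (long_elems G n) :: (_ \<Rightarrow> 'k) set)"
  proof
    fix f :: "_ \<Rightarrow> 'k" assume f: "f \<in> long_elems G (m + n)"
    show "f \<in> ideal_prod (path_algebra G) (long_elems G m) (long_elems G n)"
    proof (rule ideal_path_algebraI[OF ideal_prod_is_ideal[OF ideal_long_elems ideal_long_elems]])
      show "f \<in> carrier (path_algebra G)" using f by (simp add: long_elems_def)
      fix p assume "f p \<noteq> 0"
      then have p: "p \<in> paths G" "m + n \<le> path_len p"
        using f long_elemsD[OF f] by (auto simp: path_algebra_sel)
      \<comment> \<open>Cutting after exactly \<open>m\<close> arrows leaves at least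
        \<open>n\<close> arrows for the second factor.\<close>
      let ?p1 = "(fst p, take m (snd p))" and ?p2 = "(path_tgt G (fst p, take m (snd p)), drop m (snd p))"
      have prod: "path_prod G ?p1 ?p2 p" using p(1) by (rule path_prod_take_drop)
      then have "?p1 \<in> paths G" "?p2 \<in> paths G" unfolding path_prod_def by blast+
      then have "path_elem ?p1 \<in> (long_elems G m :: (_ \<Rightarrow> 'k) set)" "path_elem ?p2 \<in> (long_elems G n :: (_ \<Rightarrow> 'k) set)"
        using p(2) by (simp_all add: path_elem_in_long_elems_iff)
      from ideal_prod.prod[OF this, of "path_algebra G :: ('k, _) module"]
      show "(path_elem p :: _ \<Rightarrow> 'k) \<in> ideal_prod (path_algebra G) (long_elems G m) (long_elems G n)"
        by (simp only: path_algebra_mult_path_elem[OF prod])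
    qed
  qed
qed

lemma arrow_ideal_power_eq: "arrow_ideal_power G n = (long_elems G n :: (_ \<Rightarrow> 'k::field) set)"
proof (induction n)
  case 0
  \<comment> \<open>The zeroth power is the unit of the monoid of ideals, which is the whole
    carrier; every path has length at least 0.\<close>
  show ?case by (simp add: arrow_ideal_power_def nat_pow_def ideals_set_def long_elems_def)
next
  case (Suc n)
  then show ?case
    using ideal_prod_long_elems[of n 1]
    by (simp add: arrow_ideal_power_def nat_pow_def ideals_set_def arrow_ideal_eq)
qed

section \<open>The truncated algebra in terms of the coefficients of short paths\<close>

lemma truncated_class_explicit:
  assumes "f \<in> carrier (path_algebra G)"
  shows "truncated_class G n f
    = {g \<in> carrier (path_algebra G). \<forall>p. path_len p < n \<longrightarrow> g p = f p}"
proof (intro equalityI subsetI)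
  fix g assume "g \<in> truncated_class G n f"
  then obtain h where "h \<in> long_elems G n" "g = (\<lambda>p. h p + f p)"
    by (auto simp: truncated_class_def arrow_ideal_power_eq a_r_coset_def' path_algebra_sel(5))
  then show "g \<in> {g \<in> carrier (path_algebra G). \<forall>p. path_len p < n \<longrightarrow> g p = f p}"
    using assms long_elemsD(2)[of h G n]
    by (auto intro!: path_algebra_add_closed dest: long_elemsD(1)) (metis linorder_not_le)
next
  fix g assume "g \<in> {g \<in> carrier (path_algebra G). \<forall>p. path_len p < n \<longrightarrow> g p = f p}"
  then have g: "g \<in> carrier (path_algebra G)" "\<And>p. path_len p < n \<Longrightarrow> g p = f p" by auto
  \<comment> \<open>Agreement on paths shorter than \<open>n\<close> says precisely that the
    difference lies in the \<open>n\<close>-th power of the arrow ideal.\<close>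
  let ?h = "\<lambda>p. g p + - f p"
  have "?h \<in> long_elems G n"
  proof (rule long_elemsI)
    show "?h \<in> carrier (path_algebra G)"
      by (rule path_algebra_add_closed[OF g(1) path_algebra_uminus_closed[OF assms]])
    show "n \<le> path_len p" if "?h p \<noteq> 0" for p
      using that g(2)[of p] by (cases "path_len p < n") simp_all
  qed
  moreover have "g = (\<lambda>p. ?h p + f p)" by simp
  ultimately show "g \<in> truncated_class G n f"
    unfolding truncated_class_def arrow_ideal_power_eq a_r_coset_def' path_algebra_sel(5) by blast
qed

lemma truncated_class_eq_iff:
  assumes "f \<in> carrier (path_algebra G)" "g \<in> carrier (path_algebra G)"
  shows "truncated_class G n f = truncated_class G n g \<longleftrightarrow> (\<forall>p. path_len p < n \<longrightarrow> f p = g p)"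
  using assms by (auto simp: truncated_class_explicit)

lemma truncated_carrier:
  "carrier (truncated_algebra G n) = truncated_class G n ` carrier (path_algebra G)"
  by (auto simp: truncated_algebra_def quotient_algebra_def FactRing_simps truncated_class_def)

lemma truncated_class_closed:
  "f \<in> carrier (path_algebra G) \<Longrightarrow> truncated_class G n f \<in> carrier (truncated_algebra G n)"
  by (simp add: truncated_carrier)

lemma path_class_closed: "p \<in> paths G \<Longrightarrow> path_class G n p \<in> carrier (truncated_algebra G n)"
  by (simp add: path_class_eq truncated_class_closed path_elem_carrier)

lemma ideal_arrow_ideal_power: "ideal (arrow_ideal_power G n) (path_algebra G :: ('k::field, _) module)"
  by (simp add: arrow_ideal_power_eq ideal_long_elems)

lemma truncated_mult:
  assumes "f \<in> carrier (path_algebra G)" "g \<in> carrier (path_algebra G)"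
  shows "truncated_class G n f \<otimes>\<^bsub>truncated_algebra G n\<^esub> truncated_class G n g
    = truncated_class G n (f \<otimes>\<^bsub>path_algebra G\<^esub> g)"
  using ideal.rcoset_mult_add[OF ideal_arrow_ideal_power assms]
  by (simp add: truncated_algebra_def quotient_algebra_def FactRing_def truncated_class_def)

lemma truncated_add:
  fixes f g :: "_ \<Rightarrow> 'k::field"
  assumes "f \<in> carrier (path_algebra G)" "g \<in> carrier (path_algebra G)"
  shows "truncated_class G n f \<oplus>\<^bsub>truncated_algebra G n\<^esub> truncated_class G n g
    = truncated_class G n (\<lambda>p. f p + g p)"
proof -
  interpret ideal "arrow_ideal_power G n" "path_algebra G :: ('k, _) module"
    by (rule ideal_arrow_ideal_power)
  show ?thesis
    using a_rcos_sum[OF assms]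
    by (simp add: truncated_algebra_def quotient_algebra_def FactRing_def truncated_class_def
        path_algebra_sel(5))
qed

lemma truncated_zero: "\<zero>\<^bsub>truncated_algebra G n\<^esub> = truncated_class G n (\<lambda>_. 0 :: 'k::field)"
proof -
  have "long_elems G n = truncated_class G n (\<lambda>_. 0 :: 'k)"
    unfolding truncated_class_explicit[OF path_algebra_zero_closed] long_elems_def
    by (intro Collect_cong conj_cong refl) (metis not_le)
  then show ?thesis
    by (simp add: truncated_algebra_def quotient_algebra_def FactRing_def arrow_ideal_power_eq)
qed

lemma truncated_smult:
  assumes "f \<in> carrier (path_algebra G)"
  shows "c \<odot>\<^bsub>truncated_algebra G n\<^esub> truncated_class G n f = truncated_class G n (\<lambda>p. c * f p)"
proof -
  have "c \<odot>\<^bsub>truncated_algebra G n\<^esub> truncated_class G n f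
      = (\<Union>g\<in>truncated_class G n f. truncated_class G n (\<lambda>p. c * g p))"
    by (simp add: truncated_algebra_def quotient_algebra_def truncated_class_def path_algebra_sel(6))
  \<comment> \<open>Scalar multiplication in the quotient is a union over all representatives. They
    all give the same class, and the union is nonempty since \<open>f\<close> represents its own
    class.\<close>
  also have "\<dots> = (\<Union>g\<in>truncated_class G n f. truncated_class G n (\<lambda>p. c * f p))"
    using assms
    by (intro SUP_cong refl) (auto simp: truncated_class_explicit truncated_class_eq_iff path_algebra_smult_closed)
  also have "\<dots> = truncated_class G n (\<lambda>p. c * f p)"
    using assms by (auto simp: truncated_class_explicit)
  finally show ?thesis .
qed

lemma path_class_eq_zero_iff:
  assumes "p \<in> paths G"
  shows "path_class G n p = \<zero>\<^bsub>truncated_algebra G n :: ('k::field, _) module\<^esub> \<longleftrightarrow> n \<le> path_len p"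
proof -
  have "path_class G n p = \<zero>\<^bsub>truncated_algebra G n :: ('k, _) module\<^esub>
      \<longleftrightarrow> (\<forall>q. path_len q < n \<longrightarrow> path_elem p q = (0 :: 'k))"
    using assms
    by (simp add: path_class_eq truncated_zero truncated_class_eq_iff path_elem_carrier
        path_algebra_zero_closed)
  also have "\<dots> \<longleftrightarrow> n \<le> path_len p"
    unfolding path_elem_def by (metis not_le one_neq_zero)
  finally show ?thesis .
qed

lemma path_class_mult:
  assumes "path_prod G p q r"
  shows "path_class G n p \<otimes>\<^bsub>truncated_algebra G n\<^esub> path_class G n q = path_class G n r"
  using assms
  by (simp add: path_class_eq truncated_mult path_elem_carrier path_prod_def path_algebra_mult_path_elem)

text \<open>Computed on representatives, since A is handled through \<open>truncated_class\<close>
  and is not set up as an instance of \<open>ring\<close>.\<close>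

lemma truncated_mult_zero_left:
  assumes "x \<in> carrier (truncated_algebra G n :: ('k::field, _) module)"
  shows "\<zero>\<^bsub>truncated_algebra G n\<^esub> \<otimes>\<^bsub>truncated_algebra G n\<^esub> x = \<zero>\<^bsub>truncated_algebra G n\<^esub>"
proof -
  have "(\<lambda>_. 0) \<otimes>\<^bsub>path_algebra G\<^esub> f = (\<lambda>_. 0)" for f :: "_ \<Rightarrow> 'k"
    by (simp add: path_algebra_sel case_prod_unfold)
  then show ?thesis
    using assms by (auto simp: truncated_carrier truncated_zero truncated_mult path_algebra_zero_closed)
qed

lemma truncated_mult_zero_right:
  assumes "x \<in> carrier (truncated_algebra G n :: ('k::field, _) module)"
  shows "x \<otimes>\<^bsub>truncated_algebra G n\<^esub> \<zero>\<^bsub>truncated_algebra G n\<^esub> = \<zero>\<^bsub>truncated_algebra G n\<^esub>"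
proof -
  have "f \<otimes>\<^bsub>path_algebra G\<^esub> (\<lambda>_. 0) = (\<lambda>_. 0)" for f :: "_ \<Rightarrow> 'k"
    by (simp add: path_algebra_sel case_prod_unfold)
  then show ?thesis
    using assms by (auto simp: truncated_carrier truncated_zero truncated_mult path_algebra_zero_closed)
qed

lemma truncated_mult_closed:
  "x \<in> carrier (truncated_algebra G n) \<Longrightarrow> y \<in> carrier (truncated_algebra G n) \<Longrightarrow>
    x \<otimes>\<^bsub>truncated_algebra G n\<^esub> y \<in> carrier (truncated_algebra G n)"
  by (auto simp: truncated_carrier truncated_mult intro!: imageI path_algebra_mult_closed)

section \<open>The basis of short paths and its dual basis\<close>

lemma finite_basis_paths: "finite (basis_paths G n)"
proof (rule finite_subset)
  show "basis_paths G n \<subseteq> verts G \<times> {w. set w \<subseteq> arcs G \<and> length w \<le> n}"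
    by (auto simp: basis_paths_def paths_iff awalk_def)
  show "finite (verts G \<times> {w. set w \<subseteq> arcs G \<and> length w \<le> n})"
    by (intro finite_cartesian_product finite_lists_length_le) simp_all
qed

lemma abelian_monoid_truncated: "abelian_monoid (truncated_algebra G n :: ('k::field, _) module)"
  by (rule abelian_monoidI)
    (auto simp: truncated_carrier truncated_zero truncated_add path_algebra_add_closed
      path_algebra_zero_closed algebra_simps)

text \<open>Supplies the uniqueness that \<open>THE\<close> in \<open>dual_vector\<close> demands.
  Paths of length at least \<open>n\<close> have class zero, so the short ones determine a linear
  functional; outside the carrier both functionals are 0 by convention.\<close>

lemma dual_space_cong_basis:
  fixes h h' :: "_ \<Rightarrow> 'k::field"
  assumes h: "h \<in> dual_space (truncated_algebra G n)" and h': "h' \<in> dual_space (truncated_algebra G n)"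
    and eq: "\<And>p. p \<in> basis_paths G n \<Longrightarrow> h (path_class G n p) = h' (path_class G n p)"
  shows "h = h'"
proof
  fix X
  have lin: "f (truncated_class G n (\<lambda>q. g q + c * g' q)) = f (truncated_class G n g) + c * f (truncated_class G n g')"
    if "f \<in> dual_space (truncated_algebra G n)" "g \<in> carrier (path_algebra G)" "g' \<in> carrier (path_algebra G)"
    for f :: "_ \<Rightarrow> 'k" and g g' c
  proof -
    have "truncated_class G n (\<lambda>q. g q + c * g' q)
        = truncated_class G n g \<oplus>\<^bsub>truncated_algebra G n\<^esub> (c \<odot>\<^bsub>truncated_algebra G n\<^esub> truncated_class G n g')"
      using that by (simp add: truncated_add truncated_smult path_algebra_smult_closed)
    moreover have "c \<odot>\<^bsub>truncated_algebra G n\<^esub> truncated_class G n g' \<in> carrier (truncated_algebra G n)"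
      using that by (simp add: truncated_smult path_algebra_smult_closed truncated_class_closed)
    ultimately show ?thesis
      using that by (simp add: dual_space_def truncated_class_closed)
  qed
  have fzero: "f (truncated_class G n (\<lambda>_. 0)) = 0" if "f \<in> dual_space (truncated_algebra G n)" for f :: "_ \<Rightarrow> 'k"
    \<comment> \<open>With \<open>c = - 1\<close> and zero vectors, \<open>lin\<close> reads f(0) =
      f(0) - f(0).\<close>
    using lin[OF that path_algebra_zero_closed path_algebra_zero_closed, of "- 1"] by simp
  show "h X = h' X"
  proof (cases "X \<in> carrier (truncated_algebra G n)")
    case True
    then obtain f where f: "f \<in> carrier (path_algebra G)" and X: "X = truncated_class G n f"
      by (auto simp: truncated_carrier)
    from f have "h (truncated_class G n f) = h' (truncated_class G n f)"
    proof (induction rule: path_algebra_induct)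
      case zero
      show ?case by (simp only: fzero[OF h] fzero[OF h'])
    next
      case (add g c p)
      have p: "p \<in> paths G" using add f by (auto simp: path_algebra_sel)
      have "h (path_class G n p) = h' (path_class G n p)"
      proof (cases "path_len p < n")
        case True
        then show ?thesis using p eq by (simp add: basis_paths_def)
      next
        case False
        then have "path_class G n p = truncated_class G n (\<lambda>_. 0 :: 'k)"
          using p path_class_eq_zero_iff[of p n] by (simp add: truncated_zero)
        then show ?thesis by (simp only: fzero[OF h] fzero[OF h'])
      qed
      then show ?case
        using add lin[OF h add.hyps(1) path_elem_carrier[OF p]] lin[OF h' add.hyps(1) path_elem_carrier[OF p]]
        by (simp add: path_class_eq)
    qed
    then show ?thesis by (simp add: X)
  next
    case False
    then show ?thesis using h h' by (simp add: dual_space_def)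
  qed
qed

text \<open>The coefficient at \<open>p\<close> is the same in all representatives because
  \<open>p\<close> is shorter than \<open>n\<close>. It therefore defines a functional on A, and
  this functional has the property that characterizes the dual vector.\<close>

lemma dual_path_works:
  assumes p: "p \<in> basis_paths G n"
  shows "dual_path G n p \<in> dual_space (truncated_algebra G n :: ('k::field, _) module)"
    and "f \<in> carrier (path_algebra G) \<Longrightarrow> dual_path G n p (truncated_class G n f) = (f p :: 'k)"
proof -
  \<comment> \<open>Reads the coefficient off a chosen representative; the value 0 outside the
    carrier is what \<open>dual_space\<close> prescribes.\<close>
  define \<phi> :: "(_ \<Rightarrow> 'k) set \<Rightarrow> 'k" where
    "\<phi> X = (if X \<in> carrier (truncated_algebra G n) then (SOME f. f \<in> X) p else 0)" for X
  have \<phi>: "\<phi> (truncated_class G n f) = f p" if "f \<in> carrier (path_algebra G)" for f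
  proof -
    have "f \<in> truncated_class G n f" using that by (simp add: truncated_class_explicit)
    then have "(SOME g. g \<in> truncated_class G n f) \<in> truncated_class G n f"
      by (rule someI[of "\<lambda>g. g \<in> truncated_class G n f"])
    then have "(SOME g. g \<in> truncated_class G n f) p = f p"
      using that p unfolding truncated_class_explicit[OF that] basis_paths_def by blast
    then show ?thesis using that by (simp add: \<phi>_def truncated_class_closed)
  qed
  have \<phi>_dual: "\<phi> \<in> dual_space (truncated_algebra G n)"
    unfolding dual_space_def
    by (auto simp: truncated_carrier truncated_add truncated_smult \<phi> path_algebra_add_closed path_algebra_smult_closed)
      (simp add: \<phi>_def truncated_carrier)
  have val: "\<phi> (path_class G n q) = (if path_class G n q = (path_class G n p :: (_ \<Rightarrow> 'k) set) then 1 else 0)"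
    if q: "q \<in> basis_paths G n" for q
  proof -
    have carr: "path_elem q \<in> carrier (path_algebra G)" "path_elem p \<in> carrier (path_algebra G)"
      using p q by (auto simp: basis_paths_def intro: path_elem_carrier)
    \<comment> \<open>\<open>dual_vector\<close> compares classes and not paths, so distinct short
      paths must have distinct classes; the coefficient at \<open>p\<close> separates them.\<close>
    have "q = p" if "path_class G n q = (path_class G n p :: (_ \<Rightarrow> 'k) set)"
    proof -
      have "path_elem q p = (path_elem p p :: 'k)"
        using that p truncated_class_eq_iff[OF carr] unfolding path_class_eq basis_paths_def by blast
      then show ?thesis by (simp add: path_elem_def split: if_splits)
    qed
    then have "path_class G n q = (path_class G n p :: (_ \<Rightarrow> 'k) set) \<longleftrightarrow> q = p" by blast
    moreover have "\<phi> (path_class G n q) = path_elem q p"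
      unfolding path_class_eq by (rule \<phi>[OF carr(1)])
    moreover have "path_elem q p = (if q = p then 1 else 0 :: 'k)" by (simp add: path_elem_def)
    ultimately show ?thesis by simp
  qed
  have "dual_path G n p = \<phi>"
    unfolding dual_path_def dual_vector_def
  proof (rule the_equality)
    show "\<phi> \<in> dual_space (truncated_algebra G n) \<and>
      (\<forall>b'\<in>path_class G n ` basis_paths G n. \<phi> b' = (if b' = path_class G n p then 1 else 0))"
      using \<phi>_dual val by blast
  next
    fix h :: "_ \<Rightarrow> 'k"
    assume "h \<in> dual_space (truncated_algebra G n) \<and>
      (\<forall>b'\<in>path_class G n ` basis_paths G n. h b' = (if b' = path_class G n p then 1 else 0))"
    then have h: "h \<in> dual_space (truncated_algebra G n)"
      and "\<And>q. q \<in> basis_paths G n \<Longrightarrow>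
        h (path_class G n q) = (if path_class G n q = (path_class G n p :: (_ \<Rightarrow> 'k) set) then 1 else 0)"
      by blast+
    then have "h (path_class G n q) = \<phi> (path_class G n q)" if "q \<in> basis_paths G n" for q
      using that val[OF that] by presburger
    with h \<phi>_dual show "h = \<phi>" by (rule dual_space_cong_basis)
  qed
  then show "dual_path G n p \<in> dual_space (truncated_algebra G n :: ('k, _) module)"
    "f \<in> carrier (path_algebra G) \<Longrightarrow> dual_path G n p (truncated_class G n f) = f p"
    using \<phi>_dual \<phi> by simp_all
qed

lemma dual_path_path_class:
  assumes "p \<in> basis_paths G n" "q \<in> paths G"
  shows "dual_path G n p (path_class G n q) = (if p = q then 1 else 0 :: 'k::field)"
  using assms by (simp add: path_class_eq dual_path_works path_elem_carrier) (simp add: path_elem_def)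

section \<open>Values of the cocycle\<close>

lemma cocycle_path_class:
  assumes a: "a \<in> basis_paths G n" and b: "b \<in> basis_paths G n"
  shows "cocycle G n \<gamma> k (path_class G n a) (path_class G n b) z
    = (k :: 'k::field) * (\<Sum>i<path_len \<gamma>. cocycle_on_paths G n \<gamma> i a b z)"
proof -
  have "cocycle_summand G n \<gamma> i (path_class G n a) (path_class G n b) z
      = (cocycle_on_paths G n \<gamma> i a b z :: 'k)" for i
  proof -
    \<comment> \<open>The coordinates of a basis path are Kronecker deltas, which leave a single
      term of the bilinear extension.\<close>
    have "cocycle_summand G n \<gamma> i (path_class G n a) (path_class G n b) z
      = (\<Sum>a'\<in>basis_paths G n. \<Sum>b'\<in>basis_paths G n.
          if b' = b then if a' = a then cocycle_on_paths G n \<gamma> i a b z else 0 else 0 :: 'k)"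
      unfolding cocycle_summand_def
      using a b by (intro sum.cong refl) (auto simp: dual_path_path_class basis_paths_def)
    also have "\<dots> = cocycle_on_paths G n \<gamma> i a b z"
      using a b by (simp add: finite_basis_paths sum.delta)
    finally show ?thesis .
  qed
  then show ?thesis by (simp add: cocycle_def)
qed

lemma dual_path_zero:
  "p \<in> basis_paths G n \<Longrightarrow> dual_path G n p \<zero>\<^bsub>truncated_algebra G n\<^esub> = (0 :: 'k::field)"
  by (simp add: truncated_zero dual_path_works path_algebra_zero_closed)

lemma cocycle_zero_left: "cocycle G n \<gamma> (k :: 'k::field) \<zero>\<^bsub>truncated_algebra G n\<^esub> y = (\<lambda>_. 0)"
  by (simp add: cocycle_def cocycle_summand_def dual_path_zero)

lemma cocycle_zero_right: "cocycle G n \<gamma> (k :: 'k::field) x \<zero>\<^bsub>truncated_algebra G n\<^esub> = (\<lambda>_. 0)"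
  by (simp add: cocycle_def cocycle_summand_def dual_path_zero)

text \<open>A nonzero value requires a product of length at least \<open>n\<close>: the first branch
  asks for it, and the second one forces the length to be \<open>path_len \<gamma>\<close>. So
  products that survive in A carry no correction term.\<close>

lemma cocycle_short:
  assumes "path_prod G a b c" "path_len c < n" "n \<le> path_len \<gamma>"
  shows "cocycle G n \<gamma> (k :: 'k::field) (path_class G n a) (path_class G n b) = (\<lambda>_. 0)"
proof
  fix z
  have len: "path_len a + path_len b < n" using assms by (auto simp: path_prod_def)
  then have "cocycle_on_paths G n \<gamma> i a b z = (0 :: 'k)" for i
    using assms(3) by (auto simp: cocycle_on_paths_def Let_def path_prod_def cycle_segment_def)
      (metis add_diff_cancel_left' leD length_append length_map length_upt)
  moreover have "a \<in> basis_paths G n" "b \<in> basis_paths G n"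
    using assms(1) len by (auto simp: basis_paths_def path_prod_def)
  ultimately show "cocycle G n \<gamma> k (path_class G n a) (path_class G n b) z = 0"
    by (simp add: cocycle_path_class)
qed

text \<open>From length \<open>path_len \<gamma>\<close> on, only the functionals
  \<open>e\<^sup>*\<close> of trivial paths can occur. They read the coefficient of a trivial path,
  and a product that begins with an arrow contains none.\<close>

lemma cocycle_long:
  assumes \<gamma>: "\<gamma> \<in> paths G" "0 < path_len \<gamma>" "0 < n"
    and a: "a \<in> basis_paths G n" and b: "b \<in> basis_paths G n"
    and len: "path_len \<gamma> \<le> path_len a + path_len b"
    and e: "e \<in> arcs G" and f: "f \<in> carrier (path_algebra G)"
  shows "cocycle G n \<gamma> (k :: 'k::field) (path_class G n a) (path_class G n b)
     (truncated_class G n (path_elem (arrow_path G e) \<otimes>\<^bsub>path_algebra G\<^esub> f)) = 0"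
proof -
  let ?g = "path_elem (arrow_path G e) \<otimes>\<^bsub>path_algebra G\<^esub> f"
  have g: "?g \<in> carrier (path_algebra G)"
    using e f by (intro path_algebra_mult_closed path_elem_carrier arrow_path_in_paths)
  have "cocycle_on_paths G n \<gamma> i a b (truncated_class G n ?g) = 0" if "i < path_len \<gamma>" for i
  proof -
    have "cycle_arrow \<gamma> i \<in> arcs G"
      using \<gamma> by (auto simp: cycle_arrow_def paths_iff intro!: subsetD[OF _ nth_mem])
    then have "trivial_path (tail G (cycle_arrow \<gamma> i)) \<in> basis_paths G n"
      using \<gamma>(3) by (auto simp: basis_paths_def intro!: trivial_path_in_paths)
    moreover have "?g (v, []) = 0" for v
    proof (rule ccontr)
      assume "?g (v, []) \<noteq> 0"
      then obtain p q where "path_prod G p q (v, [])" "path_elem (arrow_path G e) p \<noteq> (0 :: 'k)"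
        by (rule path_algebra_mult_nonzeroE)
      then show False by (auto simp: path_prod_def path_elem_def split: if_splits)
    qed
    ultimately show ?thesis
      using len g by (simp add: cocycle_on_paths_def Let_def dual_path_works)
  qed
  then show ?thesis using a b by (simp add: cocycle_path_class)
qed

end

section \<open>Images of paths in the extension algebra\<close>

lemma path_tgt_Nil: "path_tgt Q (u, []) = u"
  by (simp add: path_tgt_def pre_digraph.awalk_verts.simps)

context wf_digraph
begin

lemma path_tgt_Cons: "path_tgt G (u, a # w) = path_tgt G (head G a, w)"
  by (simp add: path_tgt_def)

lemma path_tgt_append: "path_tgt G (u, v @ w) = path_tgt G (path_tgt G (u, v), w)"
  by (simp add: path_tgt_def awlast_append)

lemma paths_Nil_iff: "(u, []) \<in> paths G \<longleftrightarrow> u \<in> verts G"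
  by (simp add: paths_iff path_tgt_Nil awalk_Nil_iff)

lemma paths_Cons_iff: "(u, a # w) \<in> paths G \<longleftrightarrow> a \<in> arcs G \<and> u = tail G a \<and> (head G a, w) \<in> paths G"
  by (simp add: paths_iff path_tgt_Cons awalk_Cons_iff)

lemma paths_append_iff:
  "(u, v @ w) \<in> paths G \<longleftrightarrow> (u, v) \<in> paths G \<and> (path_tgt G (u, v), w) \<in> paths G"
proof (induction v arbitrary: u)
  case Nil
  show ?case using path_src_in_verts[of "(u, w)"] by (auto simp: paths_Nil_iff path_tgt_Nil)
next
  case (Cons a v)
  then show ?case by (simp add: paths_Cons_iff path_tgt_Cons)
qed

lemma path_prod_append:
  "(u, v @ w) \<in> paths G \<Longrightarrow> path_prod G (u, v) (path_tgt G (u, v), w) (u, v @ w)"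
  by (simp add: path_prod_iff)

lemma wf_extension_quiver:
  assumes "M \<subseteq> paths G"
  shows "wf_digraph (extension_quiver G M)"
proof
  fix e assume e: "e \<in> arcs (extension_quiver G M)"
  have "fst p \<in> verts G \<and> path_tgt G p \<in> verts G" if "p \<in> M" for p
    using that assms path_src_in_verts[of p] path_tgt_in_verts[of p] by blast
  with e show "tail (extension_quiver G M) e \<in> verts (extension_quiver G M)"
    "head (extension_quiver G M) e \<in> verts (extension_quiver G M)"
    by (auto simp: extension_quiver_def)
qed

end

lemma (in fin_digraph) dual_space_zero:
  fixes f :: "_ \<Rightarrow> 'k::field"
  assumes "f \<in> dual_space (truncated_algebra G n)"
  shows "f \<zero>\<^bsub>truncated_algebra G n\<^esub> = 0"
proof -
  have "0 \<odot>\<^bsub>truncated_algebra G n\<^esub> \<zero>\<^bsub>truncated_algebra G n\<^esub> = (\<zero>\<^bsub>truncated_algebra G n :: ('k, _) module\<^esub>)"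
    by (simp add: truncated_zero truncated_smult path_algebra_zero_closed)
  moreover have "\<zero>\<^bsub>truncated_algebra G n :: ('k, _) module\<^esub> \<in> carrier (truncated_algebra G n)"
    by (simp add: truncated_zero truncated_class_closed path_algebra_zero_closed)
  moreover have "f (0 \<odot>\<^bsub>truncated_algebra G n\<^esub> x) = 0 * f x" if "x \<in> carrier (truncated_algebra G n)" for x
    using assms that unfolding dual_space_def by blast
  ultimately show ?thesis by (metis mult_zero_left)
qed

lemma extension_mult:
  "(a, f) \<otimes>\<^bsub>extension_algebra Q n \<gamma> k\<^esub> (b, g) = (a \<otimes>\<^bsub>truncated_algebra Q n\<^esub> b,
    \<lambda>x. dual_lact (truncated_algebra Q n) a g x + dual_ract (truncated_algebra Q n) f b x
      + cocycle Q n \<gamma> k a b x)"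
  by (simp add: extension_algebra_def hochschild_extension_def)

lemma extension_carrier:
  "carrier (extension_algebra Q n \<gamma> k) = carrier (truncated_algebra Q n) \<times> dual_space (truncated_algebra Q n)"
  by (simp add: extension_algebra_def hochschild_extension_def)

lemma extension_zero: "\<zero>\<^bsub>extension_algebra Q n \<gamma> k\<^esub> = (\<zero>\<^bsub>truncated_algebra Q n\<^esub>, \<lambda>_. 0)"
  by (simp add: extension_algebra_def hochschild_extension_def)

lemma dual_act_zero [simp]: "dual_lact A a (\<lambda>_. 0) = (\<lambda>_. 0)" "dual_ract A (\<lambda>_. 0) b = (\<lambda>_. 0)"
  by (simp_all add: dual_lact_def dual_ract_def)

definition lift_path :: "('v, 'e) qpath \<Rightarrow> ('v, 'e + ('v, 'e) qpath) qpath" where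
  "lift_path p = (fst p, map Inl (snd p))"

text \<open>Collects the hypotheses in combinatorial form: \<open>M_subset\<close> reflects that
  basis elements are nonzero, \<open>cycles_long\<close> that oriented cycles vanish in A, and s is
  \<open>path_len \<gamma>\<close>.\<close>

locale presented_extension = fin_digraph G for G :: "('v, 'e) pre_digraph" +
  fixes n :: nat and M :: "('v, 'e) qpath set" and \<gamma> :: "('v, 'e) qpath" and k :: "'k::field"
    and \<Phi> :: "(('v, 'e + ('v, 'e) qpath) qpath \<Rightarrow> 'k)
      \<Rightarrow> (('v, 'e) qpath \<Rightarrow> 'k) set \<times> ((('v, 'e) qpath \<Rightarrow> 'k) set \<Rightarrow> 'k)"
  assumes n_ge_2: "2 \<le> n"
    and M_subset: "M \<subseteq> basis_paths G n"
    and \<gamma>_path: "\<gamma> \<in> paths G"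
    and \<gamma>_len: "n < path_len \<gamma>" "path_len \<gamma> \<le> 2 * n - 2"
    and presentation: "is_presentation G n M \<gamma> k \<Phi>"
    and cycles_long: "\<And>c. oriented_cycle G c \<Longrightarrow> n \<le> path_len c"
begin

abbreviation "E \<equiv> extension_quiver G M"
abbreviation "A \<equiv> truncated_algebra G n :: ('k, (('v, 'e) qpath \<Rightarrow> 'k) set) module"
abbreviation "T \<equiv> extension_algebra G n \<gamma> k"

text \<open>Makes the path lemmas available for the extension quiver under the prefix
  \<open>E\<close>.\<close>

sublocale E: wf_digraph E
  using M_subset by (intro wf_extension_quiver) (auto simp: basis_paths_def)

lemma extension_quiver_sel:
  "verts E = verts G" "arcs E = Inl ` arcs G \<union> Inr ` M"
  "tail E (Inl a) = tail G a" "head E (Inl a) = head G a"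
  "tail E (Inr p) = path_tgt G p" "head E (Inr p) = fst p"
  by (simp_all add: extension_quiver_def)

lemma path_tgt_lift: "path_tgt E (u, map Inl w) = path_tgt G (u, w)"
  by (induction w arbitrary: u) (simp_all add: path_tgt_Nil path_tgt_Cons E.path_tgt_Cons extension_quiver_sel)

lemma lift_in_paths_iff: "(u, map Inl w) \<in> paths E \<longleftrightarrow> (u, w) \<in> paths G"
  by (induction w arbitrary: u)
    (auto simp: paths_Nil_iff E.paths_Nil_iff paths_Cons_iff E.paths_Cons_iff extension_quiver_sel)

lemma path_prod_lift:
  "path_prod G p q r \<Longrightarrow> path_prod E (lift_path p) (lift_path q) (lift_path r)"
  by (cases p; cases q; cases r)
    (auto simp: path_prod_iff E.path_prod_iff lift_path_def lift_in_paths_iff path_tgt_lift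
      simp flip: map_append)

section \<open>The presentation on paths of old arrows\<close>

lemma Phi_mult:
  assumes "path_prod E p q r"
  shows "\<Phi> (path_elem r) = \<Phi> (path_elem p) \<otimes>\<^bsub>T\<^esub> \<Phi> (path_elem q)"
proof -
  have "\<Phi> \<in> ring_hom (path_algebra E) T"
    using presentation by (simp add: is_presentation_def algebra_hom_def)
  from ring_hom_mult[OF this, of "path_elem p" "path_elem q"] show ?thesis
    using assms by (simp add: path_algebra_mult_path_elem path_prod_def path_elem_carrier)
qed

lemma Phi_closed:
  assumes "p \<in> paths E"
  shows "fst (\<Phi> (path_elem p)) \<in> carrier A" "snd (\<Phi> (path_elem p)) \<in> dual_space A"
proof -
  have "\<Phi> \<in> ring_hom (path_algebra E) T"
    using presentation by (simp add: is_presentation_def algebra_hom_def)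
  from ring_hom_closed[OF this path_elem_carrier[OF assms]]
  show "fst (\<Phi> (path_elem p)) \<in> carrier A" "snd (\<Phi> (path_elem p)) \<in> dual_space A"
    by (auto simp: extension_carrier)
qed

text \<open>The projection of the extension algebra to A is multiplicative whatever the cocycle
  is.\<close>

lemma fst_Phi_mult:
  assumes "path_prod E p q r"
  shows "fst (\<Phi> (path_elem r)) = fst (\<Phi> (path_elem p)) \<otimes>\<^bsub>A\<^esub> fst (\<Phi> (path_elem q))"
  unfolding Phi_mult[OF assms]
  by (cases "\<Phi> (path_elem p)"; cases "\<Phi> (path_elem q)") (simp add: extension_mult)

lemma Phi_trivial_path: "v \<in> verts G \<Longrightarrow> \<Phi> (path_elem (v, [])) = (path_class G n (v, []), \<lambda>_. 0)"
  using presentation by (simp add: is_presentation_def)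

lemma Phi_arrow:
  "a \<in> arcs G \<Longrightarrow> \<Phi> (path_elem (tail G a, [Inl a])) = (path_class G n (arrow_path G a), \<lambda>_. 0)"
  using presentation by (simp add: is_presentation_def extension_quiver_sel)

lemma Phi_new_arrow:
  "p \<in> M \<Longrightarrow> \<Phi> (path_elem (path_tgt G p, [Inr p])) = (\<zero>\<^bsub>A\<^esub>, dual_path G n p)"
  using presentation by (simp add: is_presentation_def extension_quiver_sel)

lemma fst_Phi_lift:
  "(u, w) \<in> paths G \<Longrightarrow> fst (\<Phi> (path_elem (u, map Inl w))) = path_class G n (u, w)"
proof (induction w arbitrary: u)
  case Nil
  then show ?case by (simp add: paths_Nil_iff Phi_trivial_path)
next
  case (Cons a w)
  then have a: "a \<in> arcs G" "u = tail G a" "(head G a, w) \<in> paths G" by (simp_all add: paths_Cons_iff)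
  have prod: "path_prod G (arrow_path G a) (head G a, w) (u, a # w)"
    using Cons.prems a by (simp add: path_prod_iff path_tgt_Cons path_tgt_Nil)
  from fst_Phi_mult[OF path_prod_lift[OF this]] show ?case
    using a Cons.IH[OF a(3)] by (simp add: lift_path_def Phi_arrow path_class_mult[OF prod])
qed

text \<open>Every product formed while arrows are prepended is shorter than \<open>n\<close>, so
  \<open>cocycle_short\<close> removes the correction. For longer paths a component in D(A) can
  appear, and \<open>fst_Phi_lift\<close> controls only the component in A.\<close>

lemma Phi_lift_short:
  "(u, w) \<in> paths G \<Longrightarrow> length w < n \<Longrightarrow>
    \<Phi> (path_elem (u, map Inl w)) = (path_class G n (u, w), \<lambda>_. 0)"
proof (induction w arbitrary: u)
  case Nil
  then show ?case by (simp add: paths_Nil_iff Phi_trivial_path)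
next
  case (Cons a w)
  then have a: "a \<in> arcs G" "u = tail G a" "(head G a, w) \<in> paths G" by (simp_all add: paths_Cons_iff)
  have prod: "path_prod G (arrow_path G a) (head G a, w) (u, a # w)"
    using Cons.prems a by (simp add: path_prod_iff path_tgt_Cons path_tgt_Nil)
  from Phi_mult[OF path_prod_lift[OF this]] show ?case
    using a Cons.IH[OF a(3)] Cons.prems(2) cocycle_short[OF prod, of n \<gamma> k] \<gamma>_len
    by (simp add: lift_path_def Phi_arrow path_class_mult[OF prod] extension_mult)
qed

text \<open>Neither factor has a component in D(A), so only the cocycle contributes one. As the
  left-hand side depends on \<open>c\<close> alone, so does the cocycle value, and any cut of
  \<open>c\<close> into two short paths detects it.\<close>

lemma Phi_lift_prod:
  assumes "path_prod G a b c" "a \<in> basis_paths G n" "b \<in> basis_paths G n"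
  shows "\<Phi> (path_elem (lift_path c))
    = (path_class G n c, cocycle G n \<gamma> k (path_class G n a) (path_class G n b))"
proof -
  have "\<Phi> (path_elem (lift_path p)) = (path_class G n p, \<lambda>_. 0)" if "p \<in> basis_paths G n" for p
    using that Phi_lift_short[of "fst p" "snd p"] by (simp add: basis_paths_def lift_path_def)
  then show ?thesis
    using assms
    by (simp add: Phi_mult[OF path_prod_lift[OF assms(1)]] extension_mult path_class_mult)
qed

section \<open>Paths that contain new arrows\<close>

lemma fst_Phi_new_arrow:
  assumes "(u, w) \<in> paths E" "Inr p \<in> set w"
  shows "fst (\<Phi> (path_elem (u, w))) = \<zero>\<^bsub>A\<^esub>"
proof -
  \<comment> \<open>The new arrow has A-component zero, and multiplying by the pieces on either side
    of it keeps that component zero.\<close>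
  obtain w1 w2 where w: "w = w1 @ Inr p # w2" using assms(2) by (meson split_list)
  have E1: "path_prod E (u, w1) (path_tgt E (u, w1), Inr p # w2) (u, w)"
    using assms(1) w by (simp add: E.path_prod_append)
  have E2: "path_prod E (path_tgt E (u, w1), [Inr p]) (fst p, w2) (path_tgt E (u, w1), Inr p # w2)"
    using E1 E.path_src_in_verts[of "(fst p, w2)"]
    by (auto simp: E.path_prod_iff path_prod_def E.paths_Cons_iff E.path_tgt_Cons path_tgt_Nil
        E.paths_Nil_iff extension_quiver_sel)
  have "p \<in> M" "path_tgt E (u, w1) = path_tgt G p"
    using E2 by (auto simp: path_prod_def E.paths_Cons_iff extension_quiver_sel)
  then have "fst (\<Phi> (path_elem (path_tgt E (u, w1), [Inr p]))) = \<zero>\<^bsub>A\<^esub>"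
    by (simp add: Phi_new_arrow)
  moreover have "fst (\<Phi> (path_elem (fst p, w2))) \<in> carrier A"
    "fst (\<Phi> (path_elem (u, w1))) \<in> carrier A"
    using E1 E2 by (auto simp: path_prod_def intro!: Phi_closed)
  ultimately show ?thesis
    by (simp add: fst_Phi_mult[OF E1] fst_Phi_mult[OF E2] truncated_mult_zero_left truncated_mult_zero_right)
qed

lemma mult_dual_zero:
  assumes "f \<in> dual_space A"
  shows "dual_lact A \<zero>\<^bsub>A\<^esub> f = (\<lambda>_. 0)" "dual_ract A f \<zero>\<^bsub>A\<^esub> = (\<lambda>_. 0)"
  using dual_space_zero[OF assms]
  by (auto simp: dual_lact_def dual_ract_def truncated_mult_zero_left truncated_mult_zero_right)

text \<open>Both factors lie in D(A), which squares to zero: both actions involve the zero of A, and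
  the cocycle vanishes at zero.\<close>

lemma Phi_two_new_arrows:
  assumes "path_prod E (u, v) (x, w) r" "Inr p \<in> set v" "Inr q \<in> set w"
  shows "\<Phi> (path_elem r) = \<zero>\<^bsub>T\<^esub>"
proof -
  have paths: "(u, v) \<in> paths E" "(x, w) \<in> paths E" using assms(1) by (auto simp: path_prod_def)
  obtain f g where "\<Phi> (path_elem (u, v)) = (\<zero>\<^bsub>A\<^esub>, f)" "\<Phi> (path_elem (x, w)) = (\<zero>\<^bsub>A\<^esub>, g)"
    using fst_Phi_new_arrow[OF paths(1) assms(2)] fst_Phi_new_arrow[OF paths(2) assms(3)]
    by (metis prod.collapse)
  moreover from this have "f \<in> dual_space A" "g \<in> dual_space A"
    using Phi_closed(2)[OF paths(1)] Phi_closed(2)[OF paths(2)] by auto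
  moreover have "\<zero>\<^bsub>A\<^esub> \<in> carrier A"
    by (simp add: truncated_zero truncated_class_closed path_algebra_zero_closed)
  ultimately show ?thesis
    by (simp add: Phi_mult[OF assms(1)] extension_mult extension_zero truncated_mult_zero_left
        mult_dual_zero cocycle_zero_left)
qed

lemma Phi_mult_zero_left:
  assumes "path_prod E p q r" "\<Phi> (path_elem p) = \<zero>\<^bsub>T\<^esub>"
  shows "\<Phi> (path_elem r) = \<zero>\<^bsub>T\<^esub>"
proof -
  have q: "q \<in> paths E" using assms(1) by (simp add: path_prod_def)
  obtain b g where "\<Phi> (path_elem q) = (b, g)" by (cases "\<Phi> (path_elem q)")
  with Phi_closed[OF q] show ?thesis
    by (simp add: Phi_mult[OF assms(1)] assms(2) extension_mult extension_zero truncated_mult_zero_left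
        mult_dual_zero cocycle_zero_left)
qed

text \<open>The image is the functional \<open>p\<^sup>*\<close> acted on from the left by
  \<open>v\<close> and from the right by \<open>w\<close>. The convention (afb)(x) = f(bxa) puts
  \<open>w\<close> before \<open>x\<close> and \<open>v\<close> after it.\<close>

lemma Phi_one_new_arrow:
  assumes path: "(u, map Inl v @ Inr p # map Inl w) \<in> paths E"
  shows "\<Phi> (path_elem (u, map Inl v @ Inr p # map Inl w)) = (\<zero>\<^bsub>A\<^esub>,
    \<lambda>x. if x \<in> carrier A
      then dual_path G n p ((path_class G n (fst p, w) \<otimes>\<^bsub>A\<^esub> x) \<otimes>\<^bsub>A\<^esub> path_class G n (u, v)) else 0)"
proof -
  have v: "(u, v) \<in> paths G" and tgt: "path_tgt G (u, v) = path_tgt G p" and p: "p \<in> M"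
    and w: "(fst p, w) \<in> paths G"
    using path by (auto simp: E.paths_append_iff E.paths_Cons_iff lift_in_paths_iff path_tgt_lift
        extension_quiver_sel)
  have E1: "path_prod E (u, map Inl v) (path_tgt G p, [Inr p]) (u, map Inl v @ [Inr p])"
    using path by (auto simp: E.path_prod_iff E.paths_append_iff E.paths_Cons_iff E.paths_Nil_iff tgt
        path_tgt_lift extension_quiver_sel E.path_src_in_verts dest!: E.path_src_in_verts)
  have E2: "path_prod E (u, map Inl v @ [Inr p]) (fst p, map Inl w) (u, map Inl v @ Inr p # map Inl w)"
    using path by (simp add: E.path_prod_iff E.path_tgt_append E.path_tgt_Cons path_tgt_Nil extension_quiver_sel)
  have carr: "path_class G n (u, v) \<in> carrier A" "path_class G n (fst p, w) \<in> carrier A"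
    using v w by (auto intro: path_class_closed)
  have "(u, map Inl v) \<in> paths E" "(fst p, map Inl w) \<in> paths E"
    using v w by (simp_all add: lift_in_paths_iff)
  \<comment> \<open>As \<open>v\<close> and \<open>w\<close> may be long, \<open>f\<close> and
    \<open>g\<close> are unknown; the zero A-component of the new arrow annihilates them.\<close>
  then obtain f g where fg: "\<Phi> (path_elem (u, map Inl v)) = (path_class G n (u, v), f)" "f \<in> dual_space A"
    "\<Phi> (path_elem (fst p, map Inl w)) = (path_class G n (fst p, w), g)" "g \<in> dual_space A"
    using fst_Phi_lift[OF v] fst_Phi_lift[OF w] Phi_closed(2) by (metis prod.collapse)
  have "\<Phi> (path_elem (u, map Inl v @ [Inr p])) = (\<zero>\<^bsub>A\<^esub>, dual_lact A (path_class G n (u, v)) (dual_path G n p))"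
    using carr fg by (simp add: Phi_mult[OF E1] Phi_new_arrow[OF p] extension_mult truncated_mult_zero_right
        cocycle_zero_right mult_dual_zero)
  then show ?thesis
    using carr fg
    by (simp add: Phi_mult[OF E2] extension_mult truncated_mult_zero_left cocycle_zero_left mult_dual_zero)
      (auto simp: fun_eq_iff dual_ract_def dual_lact_def truncated_mult_closed)
qed

section \<open>Cycles with one new arrow\<close>

lemma elementary_imp_nonzero:
  assumes "elementary_cycle TYPE('k) G n M C"
  shows "\<Phi> (path_elem C) \<noteq> \<zero>\<^bsub>T\<^esub>"
proof -
  obtain \<delta>1 \<delta>2 p d where C: "C \<in> paths E" "C = (fst \<delta>2, map Inl (snd \<delta>2) @ Inr p # map Inl (snd \<delta>1))"
    and src: "fst \<delta>1 = fst p" and prod: "path_prod G \<delta>1 \<delta>2 d"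
    and nz: "dual_path G n p (path_class G n d) \<noteq> (0 :: 'k)"
    using assms by (auto simp: elementary_cycle_def oriented_cycle_def)
  \<comment> \<open>Evaluating the image at the trivial path between \<delta>1 and \<delta>2 gives
    the value of \<open>p\<^sup>*\<close> at their product.\<close>
  let ?e = "(path_tgt G \<delta>1, []) :: ('v, 'e) qpath"
  have \<delta>1: "\<delta>1 \<in> paths G" using prod by (simp add: path_prod_def)
  have e: "path_class G n ?e \<in> carrier A"
    using \<delta>1 by (intro path_class_closed trivial_path_in_paths path_tgt_in_verts)
  have "path_prod G \<delta>1 ?e \<delta>1"
    using \<delta>1 by (simp add: path_prod_trivial_right_iff)
  then have "(path_class G n \<delta>1 \<otimes>\<^bsub>A\<^esub> path_class G n ?e) \<otimes>\<^bsub>A\<^esub> path_class G n \<delta>2 = path_class G n d"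
    using prod by (simp add: path_class_mult)
  then have "snd (\<Phi> (path_elem C)) (path_class G n ?e) \<noteq> 0"
    using Phi_one_new_arrow[of "fst \<delta>2" "snd \<delta>2" p "snd \<delta>1"] C e nz
    by (simp flip: src)
  then show ?thesis by (auto simp: extension_zero)
qed

lemma nonzero_imp_elementary:
  assumes C: "C = (u, map Inl v @ Inr p # map Inl w)" and cyc: "oriented_cycle E C"
    and nz: "\<Phi> (path_elem C) \<noteq> \<zero>\<^bsub>T\<^esub>"
  shows "elementary_cycle TYPE('k) G n M C"
proof -
  have path: "(u, map Inl v @ Inr p # map Inl w) \<in> paths E"
    using cyc C by (simp add: oriented_cycle_def)
  let ?\<delta>1 = "(fst p, w)" and ?\<delta>2 = "(u, v)"
  have \<delta>2: "?\<delta>2 \<in> paths G" and tgt: "path_tgt G ?\<delta>2 = path_tgt G p" and p: "p \<in> M"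
    and \<delta>1: "?\<delta>1 \<in> paths G"
    using path by (auto simp: E.paths_append_iff E.paths_Cons_iff lift_in_paths_iff path_tgt_lift
        extension_quiver_sel)
  have closed: "path_tgt G ?\<delta>1 = u"
    using cyc C by (simp add: oriented_cycle_def E.path_tgt_append E.path_tgt_Cons path_tgt_lift extension_quiver_sel)
  have pb: "p \<in> basis_paths G n" using p M_subset by blast
  obtain x where x: "x \<in> carrier A"
    and xnz: "dual_path G n p ((path_class G n ?\<delta>1 \<otimes>\<^bsub>A\<^esub> x) \<otimes>\<^bsub>A\<^esub> path_class G n ?\<delta>2) \<noteq> 0"
    using nz unfolding C Phi_one_new_arrow[OF path] extension_zero
    by (auto simp: fun_eq_iff split: if_splits)
  obtain f where f: "f \<in> carrier (path_algebra G)" "x = truncated_class G n f"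
    using x by (auto simp: truncated_carrier)
  let ?h = "path_elem ?\<delta>1 \<otimes>\<^bsub>path_algebra G\<^esub> f"
  have h: "?h \<in> carrier (path_algebra G)"
    using f \<delta>1 by (intro path_algebra_mult_closed path_elem_carrier)
  \<comment> \<open>\<open>dual_path\<close> reads the coefficient at \<open>p\<close>, so
    \<open>p\<close> occurs in \<delta>1 f \<delta>2. Unfolding both products writes
    \<open>p\<close> as \<delta>1 q \<delta>2 for a path \<open>q\<close>.\<close>
  have "(?h \<otimes>\<^bsub>path_algebra G\<^esub> path_elem ?\<delta>2) p \<noteq> 0"
    using xnz h f \<delta>1 \<delta>2 dual_path_works(2)[OF pb path_algebra_mult_closed[OF h path_elem_carrier[OF \<delta>2]]]
    by (simp add: path_class_eq truncated_mult path_elem_carrier)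
  then obtain r q2 where r: "path_prod G r q2 p" "?h r \<noteq> 0" "path_elem ?\<delta>2 q2 \<noteq> (0 :: 'k)"
    by (rule path_algebra_mult_nonzeroE)
  from r(2) obtain q1 q where q: "path_prod G q1 q r" "path_elem ?\<delta>1 q1 \<noteq> (0 :: 'k)"
    by (rule path_algebra_mult_nonzeroE)
  have [simp]: "q2 = ?\<delta>2" "q1 = ?\<delta>1" using r(3) q(2) by (auto simp: path_elem_def split: if_splits)
  have "q \<in> paths G" "fst q = u" "path_tgt G q = u"
    using q(1) r(1) closed path_tgt_prod[OF q(1)] by (auto simp: path_prod_def)
  moreover have "path_len q < n"
  proof -
    have "snd r = w @ snd q" "snd p = snd r @ v" using q(1) r(1) by (simp_all add: path_prod_iff)
    then show ?thesis using pb by (simp add: basis_paths_def)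
  qed
  \<comment> \<open>If \<open>q\<close> were nontrivial, it would be an oriented cycle shorter than
    \<open>n\<close>.\<close>
  ultimately have "snd q = []"
    using cycles_long[of q] by (cases "snd q") (auto simp: oriented_cycle_def)
  then have "r = ?\<delta>1" using q(1) by (auto simp: path_prod_def)
  then have prod: "path_prod G ?\<delta>1 ?\<delta>2 p" using r(1) by simp
  \<comment> \<open>The product of \<delta>1 and \<delta>2 is \<open>p\<close> itself, where its own
    dual vector is 1.\<close>
  have "dual_path G n p (path_class G n p) \<noteq> (0 :: 'k)"
    using pb by (simp add: dual_path_path_class basis_paths_def)
  then show ?thesis
    unfolding elementary_cycle_def
    using C cyc p \<delta>1 \<delta>2 tgt prod
    by (intro conjI exI[of _ ?\<delta>1] exI[of _ ?\<delta>2] exI[of _ p]) simp_all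
qed

section \<open>Cycles without new arrows\<close>

lemma revived_imp_nonzero:
  assumes "revived_cycle G n M \<gamma> k C"
  shows "\<Phi> (path_elem C) \<noteq> \<zero>\<^bsub>T\<^esub>"
proof -
  obtain a b c where C: "C = lift_path c" and prod: "path_prod G a b c"
    and nz: "path_class G n a \<noteq> \<zero>\<^bsub>A\<^esub>" "path_class G n b \<noteq> \<zero>\<^bsub>A\<^esub>"
    and \<alpha>: "cocycle G n \<gamma> k (path_class G n a) (path_class G n b) \<noteq> (\<lambda>_. 0)"
    using assms unfolding revived_cycle_def lift_path_def by blast
  \<comment> \<open>Nonzero classes mean lengths below \<open>n\<close>, so
    \<open>Phi_lift_prod\<close> applies to this factorization.\<close>
  have "a \<in> basis_paths G n" "b \<in> basis_paths G n"
    using prod nz by (auto simp: basis_paths_def path_prod_def path_class_eq_zero_iff not_le)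
  from Phi_lift_prod[OF prod this] \<alpha> show ?thesis by (simp add: C extension_zero)
qed

text \<open>The prefix of length 2n - 2 is already at least as long as \<gamma>, so its image is a
  combination of functionals of trivial paths, and there is a next arrow to annihilate it.\<close>

lemma Phi_lift_long:
  assumes path: "(u, w) \<in> paths G" and len: "2 * n - 2 < length w"
  shows "\<Phi> (path_elem (u, map Inl w)) = \<zero>\<^bsub>T\<^esub>"
proof -
  \<comment> \<open>Length n - 1 is the largest for which a path is nonzero in A; two such pieces
    make up the prefix of length 2n - 2.\<close>
  define w1 w2 where "w1 = take (n - 1) w" and "w2 = take (n - 1) (drop (n - 1) w)"
  obtain e w3 where "drop (2 * n - 2) w = e # w3" using len by (metis drop_eq_Nil leD list.exhaust)
  then have w: "w = (w1 @ w2) @ [e] @ w3"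
    unfolding w1_def w2_def
    by (metis append.assoc append_Cons append_Nil append_take_drop_id drop_drop diff_mult_distrib2
        mult_2 nat_mult_1_right)
  have lens: "length w1 = n - 1" "length w2 = n - 1" using len n_ge_2 by (auto simp: w1_def w2_def)
  let ?a = "(u, w1)" and ?b = "(path_tgt G (u, w1), w2)" and ?c = "(u, w1 @ w2)"
  let ?d = "(u, (w1 @ w2) @ [e])"
  have c: "?c \<in> paths G" and d: "?d \<in> paths G" and e: "e \<in> arcs G"
    and tl: "path_tgt G ?c = tail G e"
    using path by (auto simp: w paths_append_iff paths_Cons_iff path_tgt_append paths_Nil_iff
        path_tgt_Cons path_tgt_Nil dest!: path_src_in_verts)
  have ab: "path_prod G ?a ?b ?c" using c by (rule path_prod_append)
  have basis: "?a \<in> basis_paths G n" "?b \<in> basis_paths G n"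
    using ab lens n_ge_2 by (auto simp: basis_paths_def path_prod_def)
  have c_zero: "path_class G n ?c = \<zero>\<^bsub>A\<^esub>"
    using c lens n_ge_2 by (simp add: path_class_eq_zero_iff)
  have ce: "path_prod G ?c (arrow_path G e) ?d" using path_prod_append[OF d] tl by simp
  let ?\<alpha> = "cocycle G n \<gamma> k (path_class G n ?a) (path_class G n ?b)"
  have e_carr: "path_class G n (arrow_path G e) \<in> carrier A"
    using e by (intro path_class_closed arrow_path_in_paths)
  have "?\<alpha> (path_class G n (arrow_path G e) \<otimes>\<^bsub>A\<^esub> x) = 0" if x: "x \<in> carrier A" for x
  proof -
    obtain f where f: "f \<in> carrier (path_algebra G)" "x = truncated_class G n f"
      using x by (auto simp: truncated_carrier)
    have "?\<alpha> (truncated_class G n (path_elem (arrow_path G e) \<otimes>\<^bsub>path_algebra G\<^esub> f)) = 0"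
      using \<gamma>_path \<gamma>_len n_ge_2 lens by (intro cocycle_long basis e f) auto
    then show ?thesis
      using f e by (simp add: path_class_eq truncated_mult path_elem_carrier arrow_path_in_paths)
  qed
  \<comment> \<open>Right multiplication by \<open>e\<close> evaluates the functional at products
    that begin with \<open>e\<close>.\<close>
  then have "dual_ract A ?\<alpha> (path_class G n (arrow_path G e)) = (\<lambda>_. 0)"
    by (auto simp: dual_ract_def)
  moreover have "\<Phi> (path_elem (lift_path ?c)) = (\<zero>\<^bsub>A\<^esub>, ?\<alpha>)"
    by (simp only: Phi_lift_prod[OF ab basis] c_zero)
  moreover have "\<Phi> (path_elem (lift_path (arrow_path G e))) = (path_class G n (arrow_path G e), \<lambda>_. 0)"
    using e by (simp add: lift_path_def Phi_arrow)
  ultimately have d_zero: "\<Phi> (path_elem (lift_path ?d)) = \<zero>\<^bsub>T\<^esub>"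
    using e_carr unfolding Phi_mult[OF path_prod_lift[OF ce]]
    by (simp add: extension_mult extension_zero truncated_mult_zero_left cocycle_zero_left)
  have "path_prod G ?d (path_tgt G ?d, w3) (u, w)"
    using path path_prod_append[of u "(w1 @ w2) @ [e]" w3] by (simp add: w)
  from Phi_mult_zero_left[OF path_prod_lift[OF this] d_zero] show ?thesis
    by (simp add: lift_path_def)
qed

lemma nonzero_imp_revived:
  assumes C: "C = (u, map Inl w)" and cyc: "oriented_cycle E C"
    and nz: "\<Phi> (path_elem C) \<noteq> \<zero>\<^bsub>T\<^esub>"
  shows "revived_cycle G n M \<gamma> k C"
proof -
  have path: "(u, w) \<in> paths G" using cyc C by (simp add: oriented_cycle_def lift_in_paths_iff)
  have "oriented_cycle G (u, w)"
    using cyc C by (simp add: oriented_cycle_def lift_in_paths_iff path_tgt_lift)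
  then have len: "n \<le> length w" using cycles_long by fastforce
  have len': "length w \<le> 2 * n - 2" using Phi_lift_long[OF path] nz C by (meson not_le)
  \<comment> \<open>The bounds on the length of \<open>w\<close> leave between 1 and n - 1 arrows
    for the second factor, so both factors are nontrivial and nonzero in A.\<close>
  let ?a = "(u, take (n - 1) w)"
  let ?b = "(path_tgt G ?a, drop (n - 1) w)"
  have prod: "path_prod G ?a ?b (u, w)" using path_prod_take_drop[OF path, of "n - 1"] by simp
  have basis: "?a \<in> basis_paths G n" "?b \<in> basis_paths G n"
    using prod len len' n_ge_2 by (auto simp: basis_paths_def path_prod_def)
  have "path_class G n (u, w) = \<zero>\<^bsub>A\<^esub>" using path len by (simp add: path_class_eq_zero_iff)
  then have \<alpha>: "cocycle G n \<gamma> k (path_class G n ?a) (path_class G n ?b) \<noteq> (\<lambda>_. 0)"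
    using Phi_lift_prod[OF prod basis] nz by (simp add: C lift_path_def extension_zero)
  have "path_class G n ?a \<noteq> \<zero>\<^bsub>A\<^esub>" "path_class G n ?b \<noteq> \<zero>\<^bsub>A\<^esub>"
    using basis by (auto simp: path_class_eq_zero_iff basis_paths_def)
  moreover have "1 \<le> path_len ?a" "1 \<le> path_len ?b" using len n_ge_2 by auto
  moreover have "C = (fst (u, w), map Inl (snd (u, w)))" by (simp add: C)
  ultimately show ?thesis
    unfolding revived_cycle_def using cyc prod \<alpha> by blast
qed

section \<open>Case distinction on the number of new arrows\<close>

lemma nonzero_cycle_cases:
  assumes cyc: "oriented_cycle E C" and nz: "\<Phi> (path_elem C) \<noteq> \<zero>\<^bsub>T\<^esub>"
  shows "elementary_cycle TYPE('k) G n M C \<or> revived_cycle G n M \<gamma> k C"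
proof -
  have old: "\<exists>w'. w = map Inl w'" if "\<nexists>p. Inr p \<in> set w" for w :: "('e + ('v, 'e) qpath) list"
    using that by (metis ex_map_conv sum.exhaust)
  obtain u w where C: "C = (u, w)" by (cases C)
  have path: "(u, w) \<in> paths E" using cyc C by (simp add: oriented_cycle_def)
  show ?thesis
  proof (cases "\<exists>p. Inr p \<in> set w")
    case False
    then show ?thesis using old nonzero_imp_revived[OF _ cyc nz] C by blast
  next
    case True
    \<comment> \<open>Splitting at the first new arrow makes \<open>w1\<close> a list of old arrows,
      so only \<open>w2\<close> remains to be examined.\<close>
    then obtain w1 p w2 where w: "w = w1 @ Inr p # w2" and w1: "\<nexists>q. Inr q \<in> set w1"
      using split_list_first_prop[of w "\<lambda>x. \<exists>p. x = Inr p"] by metis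
    show ?thesis
    proof (cases "\<exists>q. Inr q \<in> set w2")
      case True
      then obtain q where q: "Inr q \<in> set w2" by blast
      \<comment> \<open>The cut just behind the first new arrow leaves one new arrow in each
        factor.\<close>
      have "path_prod E (u, w1 @ [Inr p]) (path_tgt E (u, w1 @ [Inr p]), w2) C"
        using path E.path_prod_append[of u "w1 @ [Inr p]" w2] by (simp add: C w)
      from Phi_two_new_arrows[OF this _ q, of p] nz show ?thesis by simp
    next
      case False
      then show ?thesis using old[OF w1] old[OF False] nonzero_imp_elementary[OF _ cyc nz] C w by blast
    qed
  qed
qed

end

text \<open>A path of length at least \<open>n\<close> has class zero, which cannot belong to a
  linearly independent set.\<close>

lemma (in fin_digraph) is_basis_subset_basis_paths:
  assumes "M \<subseteq> paths G" "is_basis (truncated_algebra G n :: ('k::field, _) module) S (path_class G n ` M)"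
  shows "M \<subseteq> basis_paths G n"
proof
  fix p assume p: "p \<in> M"
  let ?A = "truncated_algebra G n :: ('k, _) module"
  have indep: "lin_indep ?A (path_class G n ` M)" using assms(2) by (simp add: is_basis_def)
  show "p \<in> basis_paths G n"
  proof (rule ccontr)
    assume "p \<notin> basis_paths G n"
    then have "p \<in> paths G" "n \<le> path_len p"
      using p assms(1) by (auto simp: basis_paths_def)
    then have z: "path_class G n p = \<zero>\<^bsub>?A\<^esub>" by (simp add: path_class_eq_zero_iff)
    interpret abelian_monoid ?A by (rule abelian_monoid_truncated)
    \<comment> \<open>The singleton of the zero class, taken with coefficient 1, is the forbidden
      linear relation.\<close>
    have "(\<Oplus>\<^bsub>?A\<^esub>b\<in>{\<zero>\<^bsub>?A\<^esub>}. 1 \<odot>\<^bsub>?A\<^esub> b) = \<zero>\<^bsub>?A\<^esub>"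
      by (simp add: truncated_smult truncated_zero truncated_add truncated_class_closed path_algebra_zero_closed)
    moreover have "\<zero>\<^bsub>?A\<^esub> \<in> path_class G n ` M" using p z by (metis imageI)
    ultimately have "(1 :: 'k) = 0"
      using indep unfolding lin_indep_def
      by (elim conjE allE[of _ "{\<zero>\<^bsub>?A\<^esub>}"] allE[of _ "\<lambda>_. 1"]) simp
    then show False by simp
  qed
qed

theorem theorem3p2:
  fixes \<Delta> :: "('v, 'e) pre_digraph"
    and n s :: nat
    and k :: "'k::alg_closed_field"
    and M :: "('v, 'e) qpath set"
    and \<gamma> :: "('v, 'e) qpath"
    and \<Phi> :: "(('v, 'e + ('v, 'e) qpath) qpath \<Rightarrow> 'k)
      \<Rightarrow> (('v, 'e) qpath \<Rightarrow> 'k) set \<times> ((('v, 'e) qpath \<Rightarrow> 'k) set \<Rightarrow> 'k)"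
    and C :: "('v, 'e + ('v, 'e) qpath) qpath"
  defines "A \<equiv> truncated_algebra \<Delta> n :: ('k, (('v, 'e) qpath \<Rightarrow> 'k) set) module"
  assumes "fin_digraph \<Delta>" and "connected \<Delta>"
    and "n \<ge> 2"
    and "\<And>c. oriented_cycle \<Delta> c \<Longrightarrow> path_class \<Delta> n c = \<zero>\<^bsub>A\<^esub>"
    and "alg_dim A > 1"
    and "M \<subseteq> paths \<Delta>"
    and "inj_on (path_class \<Delta> n :: _ \<Rightarrow> (_ \<Rightarrow> 'k) set) M"
    and "is_basis A (bimodule_socle A) (path_class \<Delta> n ` M)"
    and "oriented_cycle \<Delta> \<gamma>" and "path_len \<gamma> = s"
    and "n + 1 \<le> s" and "s \<le> 2 * n - 2"
    and "k \<noteq> 0"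
    and "is_presentation \<Delta> n M \<gamma> k \<Phi>"
    and "oriented_cycle (extension_quiver \<Delta> M) C"
  shows "elementary_cycle TYPE('k) \<Delta> n M C \<or> revived_cycle \<Delta> n M \<gamma> k C
    \<longleftrightarrow> \<Phi> (path_elem C) \<noteq> \<zero>\<^bsub>extension_algebra \<Delta> n \<gamma> k\<^esub>"
proof -
  interpret \<Delta>: fin_digraph \<Delta> by fact
  interpret presented_extension \<Delta> n M \<gamma> k \<Phi>
  proof unfold_locales
    show "M \<subseteq> basis_paths \<Delta> n"
      using assms(7,9) unfolding A_def by (rule \<Delta>.is_basis_subset_basis_paths)
    show "n \<le> path_len c" if "oriented_cycle \<Delta> c" for c
      using assms(5)[OF that] that \<Delta>.path_class_eq_zero_iff
      unfolding A_def oriented_cycle_def by blast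
  qed (use assms in \<open>auto simp: oriented_cycle_def\<close>)
  show ?thesis
    using elementary_imp_nonzero revived_imp_nonzero nonzero_cycle_cases assms(16) by blast
qed

end
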